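(* Let $A$ and $B$ be fixed non-special polynomials of degree at least two such that the set $\mathcal{E}(A,B)$ is non-empty, and let $X_0$ be an element of $\mathcal{E}(A,B)$ of the minimum possible degree. Then a polynomial $X$ belongs to $\mathcal{E}(A,B)$ if and only if $X=\widetilde{A}\circ X_0$ for some polynomial $\widetilde{A}$ commuting with $A$, i.e. such that $\widetilde{A}\circ A=A\circ\widetilde{A}$.
   Context: All polynomials have complex coefficients. For fixed polynomials $A,B$, $\mathcal{E}(A,B)$ denotes the (possibly empty) set of polynomials $X$ of degree at least two such that $A\circ X=X\circ B$. Two polynomials $P,Q$ are conjugate if $Q=\lambda\circ P\circ\lambda^{-1}$ for some polynomial $\lambda$ of degree one. A polynomial $P$ of degree $n\ge 2$ is called special if it is conjugate to $z^n$ or to $\pm T_n$, where $T_n$ is the Chebyshev polynomial defined by $T_n(\cos\theta)=\cos n\theta$; otherwise it is non-special.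
   Formalization: The commuting polynomial Ã is required to be non-constant: a constant c with A(c)=c also commutes with A, but then Ã∘X_0 is constant and does not belong to E(A,B). *)

theory Defs
  imports "HOL-Analysis.Analysis" "HOL-Computational_Algebra.Computational_Algebra"
begin

definition chebyshev_poly :: "nat \<Rightarrow> complex poly" where
  "chebyshev_poly n = (THE T. \<forall>\<theta>::real. poly T (of_real (cos \<theta>)) = of_real (cos (real n * \<theta>)))"

lemma chebyshev_poly_ex1:
  "\<exists>!T :: complex poly. \<forall>\<theta>::real. poly T (of_real (cos \<theta>)) = of_real (cos (real n * \<theta>))"
proof -
  have ex: "\<exists>T :: complex poly. \<forall>\<theta>::real. poly T (of_real (cos \<theta>)) = of_real (cos (real n * \<theta>))" for n
  proof (induction n rule: induct_nat_012)
    case 0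
    show ?case by (rule exI[of _ "1"]) simp
  next
    case 1
    show ?case by (rule exI[of _ "[:0, 1:]"]) simp
  next
    case (ge2 n)
    then obtain S T :: "complex poly"
      where S: "\<And>\<theta>. poly S (of_real (cos \<theta>)) = of_real (cos (real n * \<theta>))"
        and T: "\<And>\<theta>. poly T (of_real (cos \<theta>)) = of_real (cos (real (Suc n) * \<theta>))"
      by blast
    have "cos (real (Suc (Suc n)) * \<theta>) = 2 * cos \<theta> * cos (real (Suc n) * \<theta>) - cos (real n * \<theta>)" for \<theta>
    proof -
      have "real (Suc (Suc n)) * \<theta> = real (Suc n) * \<theta> + \<theta>" "real n * \<theta> = real (Suc n) * \<theta> - \<theta>"
        by (simp_all add: algebra_simps)
      then show ?thesis by (simp only: cos_add cos_diff) (simp add: algebra_simps)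
    qed
    then have "\<forall>\<theta>. poly ([:0, 2:] * T - S) (of_real (cos \<theta>)) = of_real (cos (real (Suc (Suc n)) * \<theta>))"
      by (simp add: S T)
    then show ?case by blast
  qed
  have "S = T"
    if S: "\<forall>\<theta>. poly S (of_real (cos \<theta>)) = of_real (cos (real n * \<theta>))"
      and T: "\<forall>\<theta>. poly T (of_real (cos \<theta>)) = of_real (cos (real n * \<theta>))"
    for S T :: "complex poly"
  proof (rule ccontr)
    assume "S \<noteq> T"
    then have fin: "finite {z. poly (S - T) z = 0}" by (intro poly_roots_finite) simp
    have "(of_real :: real \<Rightarrow> complex) ` {-1..1} \<subseteq> {z. poly (S - T) z = 0}"
    proof safe
      fix x :: real assume "x \<in> {-1..1}"
      then have "x = cos (arccos x)" by simp
      then show "poly (S - T) (of_real x) = 0" using S T by (metis poly_diff right_minus_eq)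
    qed
    then have "finite ((of_real :: real \<Rightarrow> complex) ` {-1..1})"
      using fin by (rule finite_subset)
    then have "finite {-1..(1::real)}"
      by (rule finite_imageD) (simp add: inj_on_def)
    then show False by (simp add: infinite_Icc)
  qed
  with ex[of n] show ?thesis by blast
qed

lemma poly_chebyshev_poly_cos:
  "poly (chebyshev_poly n) (of_real (cos \<theta>)) = of_real (cos (real n * \<theta>))"
  using theI'[OF chebyshev_poly_ex1[of n]] unfolding chebyshev_poly_def by blast

definition conjugate_poly :: "complex poly \<Rightarrow> complex poly \<Rightarrow> bool" where
  "conjugate_poly P Q \<longleftrightarrow>
    (\<exists>L M. degree L = 1 \<and> L \<circ>\<^sub>p M = [:0, 1:] \<and> M \<circ>\<^sub>p L = [:0, 1:] \<and> Q = L \<circ>\<^sub>p P \<circ>\<^sub>p M)"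

definition special_poly :: "complex poly \<Rightarrow> bool" where
  "special_poly P \<longleftrightarrow> degree P \<ge> 2 \<and>
    (conjugate_poly P (monom 1 (degree P)) \<or>
     conjugate_poly P (chebyshev_poly (degree P)) \<or>
     conjugate_poly P (- chebyshev_poly (degree P)))"

definition semiconj_polys :: "complex poly \<Rightarrow> complex poly \<Rightarrow> complex poly set" where
  "semiconj_polys A B = {X. degree X \<ge> 2 \<and> A \<circ>\<^sub>p X = X \<circ>\<^sub>p B}"

end

theory Submission
  imports Defs "HOL-Computational_Algebra.Field_as_Ring"
begin

text \<open>Laurent series in \<open>x = 1/w\<close> serve as germs at infinity. A polynomial \<open>A\<close> of degree \<open>n \<ge> 2\<close> has a
Boettcher series \<open>f\<close>, with a simple pole and \<open>A(f(w)) = f(w^n)\<close>; a solution \<open>g\<close> of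
\<open>A(g(w)) = g(w^n)\<close> with a pole of order \<open>k \<ge> 1\<close> is determined by its leading coefficient, so it
is \<open>f(c w^k)\<close> for a constant \<open>c\<close>. If \<open>b\<close> is a Boettcher series of \<open>B\<close> and \<open>A \<circ> X = X \<circ> B\<close> with
\<open>deg X = k \<ge> 1\<close>, then \<open>X(b(w))\<close> is such a \<open>g\<close>. So a semiconjugacy \<open>X\<close> is \<open>w \<mapsto> c w^k\<close> in
Boettcher coordinates.

Suppose \<open>X\<^sub>0\<close> and \<open>X\<close> are semiconjugacies from \<open>B\<close> to \<open>A\<close> and \<open>deg X = m deg X\<^sub>0\<close>. For a
suitable \<open>d\<close> let \<open>C\<close> be the polynomial with \<open>C(f(w)) = f(d w^m) + O(1/w)\<close>. Then \<open>C \<circ> X\<^sub>0\<close> and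
\<open>X\<close> agree at \<open>b\<close> up to \<open>O(1/w)\<close>, so they are equal, and \<open>C\<close> commutes with \<open>A\<close> because it does so
after composition with \<open>X\<^sub>0\<close>. This is \<open>left_factor_of_semiconj\<close>. The rest of the proof shows
that the least degree divides all others (\<open>degree_dvd_of_semiconj\<close>): otherwise \<open>A\<close> is special.

Let \<open>X\<close>, \<open>Y\<close> have degrees \<open>g k\<close>, \<open>g l\<close> with coprime \<open>k, l \<ge> 2\<close>. The polynomial \<open>H\<close> with
\<open>H(b(w)) = w^(gkl) + O(1/w)\<close> factors through both \<open>X\<close> and \<open>Y\<close>, so \<open>H(b(w))\<close> is a series in both
\<open>w^(gk)\<close> and \<open>w^(gl)\<close>, hence in \<open>w^(gkl)\<close>. The two cofactors turn \<open>f\<close> into \<open>s(c w^l)\<close> and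
\<open>s(c' w^k)\<close> for one series \<open>s\<close>, and the construction can be repeated with \<open>f\<close>, \<open>s\<close> in place of
\<open>b\<close>, \<open>f\<close>. Composing along this tower gives, for every \<open>N = k^i l^j\<close>, a polynomial of degree \<open>N\<close>
whose value at \<open>f\<close> is a series in \<open>w^N\<close> (\<open>ex_gap_poly_powers\<close>); normalised, it satisfies
\<open>H\<^sub>N(f(w)) = w^N + e w^(-N) + O(w^(-2N))\<close>, as a Chebyshev polynomial would at \<open>w + 1/w\<close>.

Put \<open>h = w f'(w)\<close>. If \<open>N < N + J\<close> are two such exponents with small \<open>J\<close>, the analogue of the
formula for \<open>sin(\<alpha> - \<beta>)\<close> is the Wronskian \<open>N H\<^sub>N H\<^sub>M' - M H\<^sub>M H\<^sub>N'\<close>, where \<open>M = N + J\<close>. If the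
coefficient \<open>e\<close> for \<open>N\<close> is not zero, it is the derivative of a polynomial \<open>G\<close> of degree \<open>J\<close> that
looks like a Chebyshev polynomial to an order near \<open>N\<close>, and \<open>J\<^sup>2 (G\<^sup>2 - const) / G'\<^sup>2\<close>
approximates \<open>h\<^sup>2\<close> far better than its degree suggests. As \<open>log k / log l\<close> is irrational, the
numbers \<open>k^i l^j\<close> contain an infinite sequence with successive ratios at most \<open>9/8\<close>. Two
successive approximants then agree to a higher order than distinct quotients of their degrees
can, so all are equal; if some \<open>e\<close> is zero, the Wronskians vanish from there on and
\<open>N\<^sup>2 H\<^sub>N\<^sup>2 / H\<^sub>N'\<^sup>2\<close> is an approximant that does not depend on \<open>N\<close>. Either way,
\<open>h\<^sup>2 = p(f)/q(f)\<close> for polynomials \<open>p\<close>, \<open>q\<close> (\<open>euler_square_rational\<close>).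

Finally, \<open>A(f(w)) = f(w^n)\<close> turns this into \<open>A'\<^sup>2 (p/q) = n\<^sup>2 (p/q) \<circ> A\<close>. Comparing denominators
makes \<open>q\<close> constant, comparing poles makes \<open>p\<close> quadratic, and the solutions of this differential
equation are conjugate to \<open>z^n\<close> when \<open>p\<close> has a double root and to \<open>\<plusminus>T\<^sub>n\<close> otherwise
(\<open>special_if_functional_equation\<close>).\<close>

section \<open>Laurent series in 1/w\<close>

definition eval_fls :: "complex poly \<Rightarrow> complex fls \<Rightarrow> complex fls" where
  "eval_fls P f = poly (map_poly fls_const P) f"

lemma eval_fls_0 [simp]: "eval_fls 0 f = 0"
  by (simp add: eval_fls_def)

lemma eval_fls_pCons [simp]: "eval_fls (pCons a P) f = fls_const a + f * eval_fls P f"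
  by (simp add: eval_fls_def map_poly_pCons)

lemma eval_fls_1 [simp]: "eval_fls 1 f = 1"
  using eval_fls_pCons[of 1 0 f] by (simp add: one_pCons)

lemma eval_fls_add [simp]: "eval_fls (P + Q) f = eval_fls P f + eval_fls Q f"
proof (induction P arbitrary: Q)
  case (pCons a P)
  obtain b q where Q: "Q = pCons b q" by (cases Q)
  show ?case
    using pCons.IH[of q] by (simp add: Q fls_plus_const[symmetric] distrib_left add_ac)
qed simp

lemma eval_fls_smult [simp]: "eval_fls (smult c P) f = fls_const c * eval_fls P f"
  by (induction P) (simp_all add: algebra_simps)

lemma eval_fls_minus [simp]: "eval_fls (- P) f = - eval_fls P f"
  using eval_fls_smult[of "-1" P f] by simp

lemma eval_fls_diff [simp]: "eval_fls (P - Q) f = eval_fls P f - eval_fls Q f"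
  using eval_fls_add[of P "- Q" f] by simp

lemma eval_fls_mult [simp]: "eval_fls (P * Q) f = eval_fls P f * eval_fls Q f"
  by (induction P) (simp_all add: algebra_simps)

lemma eval_fls_power [simp]: "eval_fls (P ^ n) f = eval_fls P f ^ n"
  by (induction n) simp_all

lemma eval_fls_monom [simp]: "eval_fls (monom c n) f = fls_const c * f ^ n"
  by (induction n) (simp_all add: monom_0 monom_Suc algebra_simps)

lemma eval_fls_pcompose [simp]: "eval_fls (P \<circ>\<^sub>p Q) f = eval_fls P (eval_fls Q f)"
  by (induction P) (simp_all add: pcompose_pCons)

lemma subdegree_eval_fls:
  assumes f: "fls_subdegree f < 0" and "P \<noteq> 0"
  shows "eval_fls P f \<noteq> 0 \<and> fls_subdegree (eval_fls P f) = int (degree P) * fls_subdegree f"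
  using assms(2)
proof (induction P)
  case (pCons a P)
  have f0: "f \<noteq> 0" using f by auto
  show ?case
  proof (cases "P = 0")
    case False
    note IH = pCons.IH[OF False]
    have nz: "f * eval_fls P f \<noteq> 0" using IH f0 by simp
    have sd: "fls_subdegree (f * eval_fls P f) = int (Suc (degree P)) * fls_subdegree f"
      using IH f0 by (simp add: algebra_simps)
    have neg: "fls_subdegree (f * eval_fls P f) < 0"
      unfolding sd using f by (simp add: mult_pos_neg)
    have "fls_subdegree (fls_const a + f * eval_fls P f) = fls_subdegree (f * eval_fls P f)"
      using nz neg by (cases "a = 0") (simp_all add: fls_subdegree_add_eq2)
    with sd neg False show ?thesis by auto
  qed (use pCons in simp)
qed simp

lemma subdegree_eval_fls_simple_pole:
  assumes "fls_subdegree f = -1"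
  shows "fls_subdegree (eval_fls P f) = - int (degree P)"
  using subdegree_eval_fls[of f P] assms by (cases "P = 0") auto

lemma eval_fls_eq_iff:
  assumes "fls_subdegree f < 0"
  shows "eval_fls P f = eval_fls Q f \<longleftrightarrow> P = Q"
  using subdegree_eval_fls[OF assms, of "P - Q"] by auto

text \<open>The relation \<open>f = O(x^m)\<close>. Unlike a bound on \<^const>\<open>fls_subdegree\<close>, it also
holds for \<open>f = 0\<close>.\<close>

definition ord_ge :: "int \<Rightarrow> complex fls \<Rightarrow> bool" where
  "ord_ge m f \<longleftrightarrow> (\<forall>i<m. fls_nth f i = 0)"

lemma ord_geD: "ord_ge m f \<Longrightarrow> i < m \<Longrightarrow> fls_nth f i = 0"
  by (simp add: ord_ge_def)

lemma ord_ge_iff: "ord_ge m f \<longleftrightarrow> f = 0 \<or> m \<le> fls_subdegree f"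
  unfolding ord_ge_def by (metis fls_eq0_below_subdegree fls_subdegree_geI fls_zero_nth order_less_le_trans)

lemma ord_ge_subdegree: "ord_ge (fls_subdegree f) f"
  by (simp add: ord_ge_iff)

lemma ord_ge_0 [simp]: "ord_ge m 0"
  by (simp add: ord_ge_def)

lemma ord_ge_mono: "ord_ge m f \<Longrightarrow> k \<le> m \<Longrightarrow> ord_ge k f"
  by (simp add: ord_ge_def)

lemma ord_ge_add: "ord_ge m f \<Longrightarrow> ord_ge m g \<Longrightarrow> ord_ge m (f + g)"
  by (simp add: ord_ge_def)

lemma ord_ge_diff: "ord_ge m f \<Longrightarrow> ord_ge m g \<Longrightarrow> ord_ge m (f - g)"
  by (simp add: ord_ge_def)

lemma ord_ge_mult:
  assumes "ord_ge m f" "ord_ge k g" "j \<le> m + k"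
  shows "ord_ge j (f * g)"
proof (cases "f = 0 \<or> g = 0")
  case False
  then have "fls_subdegree (f * g) = fls_subdegree f + fls_subdegree g" by simp
  with assms False show ?thesis by (auto simp: ord_ge_iff)
qed auto

lemma ord_ge_const: "ord_ge 0 (fls_const c)"
  by (simp add: ord_ge_def)

lemma ord_ge_cancel:
  assumes "ord_ge m (f * g)" "g \<noteq> 0" "fls_subdegree g \<le> k"
  shows "ord_ge (m - k) f"
proof (cases "f = 0")
  case False
  then have "fls_subdegree (f * g) = fls_subdegree f + fls_subdegree g" using assms by simp
  with assms False show ?thesis by (auto simp: ord_ge_iff)
qed auto

lemma eq_0_if_ord_ge: "(\<And>n::nat. ord_ge (int n) f) \<Longrightarrow> f = 0"
proof (rule ccontr)
  assume *: "\<And>n::nat. ord_ge (int n) f" and "f \<noteq> 0"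
  then show False using *[of "nat (fls_subdegree f + 1)"] by (simp add: ord_ge_iff split: if_splits)
qed

text \<open>A nonzero polynomial in a series with a simple pole has order at most \<open>0\<close>. Equalities between
polynomials are deduced from this all through the proof: it is enough to compare values up to \<open>O(1/w)\<close>.\<close>

lemma eval_fls_eq_0_if_ord_ge_1:
  assumes "fls_subdegree f = -1" "ord_ge 1 (eval_fls P f)"
  shows "P = 0"
proof (rule ccontr)
  assume "P \<noteq> 0"
  then show False using subdegree_eval_fls[of f P] assms by (auto simp: ord_ge_iff)
qed

text \<open>The powers of \<open>f\<close> have leading terms \<open>w^j\<close> up to constants, so subtracting multiples of them removes
the nonnegative powers of \<open>w\<close> in \<open>g\<close> one after the other. For \<open>g = w^n\<close> the result is a Faber polynomial.\<close>

lemma ex_polynomial_part: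
  assumes f: "fls_subdegree f = -1"
  shows "\<exists>P. ord_ge 1 (eval_fls P f - g)"
proof -
  have f0: "f \<noteq> 0" using f by auto
  have "\<exists>P. ord_ge 1 (eval_fls P f - g)" if "ord_ge (- int n) g" for n g
    using that
  proof (induction n arbitrary: g)
    case 0
    have "ord_ge 1 (eval_fls [:fls_nth g 0:] f - g)"
      using 0 by (auto simp: ord_ge_def)
    then show ?case ..
  next
    case (Suc n)
    define c where "c = fls_nth g (- int (Suc n)) / fls_nth f (-1) ^ Suc n"
    define h where "h = g - fls_const c * f ^ Suc n"
    have lc: "fls_nth f (-1) \<noteq> 0" using nth_fls_subdegree_nonzero[OF f0] f by simp
    have "fls_subdegree (f ^ Suc n) = - int (Suc n)"
      using f by (simp add: fls_subdegree_pow del: power_Suc)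
    then have o: "ord_ge (- int (Suc n)) (f ^ Suc n)" by (metis ord_ge_subdegree)
    have co: "fls_nth (f ^ Suc n) (- int (Suc n)) = fls_nth f (-1) ^ Suc n"
      using fls_pow_base[of f "Suc n"] f by (simp del: power_Suc)
    have "ord_ge (- int n) h"
      unfolding ord_ge_def
    proof safe
      fix i assume i: "i < - int n"
      show "fls_nth h i = 0"
      proof (cases "i = - int (Suc n)")
        case True
        then show ?thesis
          unfolding h_def using co lc
          by (simp add: c_def del: power_Suc of_nat_Suc)
      next
        case False
        then have "i < - int (Suc n)" using i by simp
        then show ?thesis
          unfolding h_def using ord_geD[OF o] ord_geD[OF Suc.prems]
          by (simp del: power_Suc of_nat_Suc)
      qed
    qed
    then obtain P where P: "ord_ge 1 (eval_fls P f - h)" using Suc.IH by blast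
    have "eval_fls (P + monom c (Suc n)) f - g = eval_fls P f - h"
      by (simp add: h_def del: power_Suc)
    then show ?case using P by metis
  qed
  moreover have "ord_ge (- int (nat (- fls_subdegree g))) g"
    by (rule ord_ge_mono[OF ord_ge_subdegree]) simp
  ultimately show ?thesis by blast
qed

text \<open>The substitution \<open>x \<mapsto> c x^n\<close>, that is, \<open>w \<mapsto> w^n / c\<close>.\<close>

definition subst_monom :: "complex \<Rightarrow> nat \<Rightarrow> complex fls \<Rightarrow> complex fls" where
  "subst_monom c n f = fls_compose_power (fls_compose_fps f (fps_const c * fps_X)) n"

lemma subst_monom_nth:
  assumes "c \<noteq> 0" "n > 0"
  shows "fls_nth (subst_monom c n f) i = (if int n dvd i then fls_nth f (i div int n) * c powi (i div int n) else 0)"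
  using assms by (simp add: subst_monom_def fls_nth_compose_power fls_nth_fls_compose_fps_linear)

lemma
  assumes "c \<noteq> 0" "n > 0"
  shows subst_monom_add: "subst_monom c n (f + g) = subst_monom c n f + subst_monom c n g"
    and subst_monom_diff: "subst_monom c n (f - g) = subst_monom c n f - subst_monom c n g"
    and subst_monom_mult: "subst_monom c n (f * g) = subst_monom c n f * subst_monom c n g"
    and subst_monom_const: "subst_monom c n (fls_const a) = fls_const a"
  using assms by (simp_all add: subst_monom_def fls_compose_fps_add fls_compose_fps_mult fls_compose_fps_diff)

lemma subst_monom_power: "c \<noteq> 0 \<Longrightarrow> n > 0 \<Longrightarrow> subst_monom c n (f ^ k) = subst_monom c n f ^ k"
  by (induction k) (use subst_monom_const[of c n 1] in \<open>simp_all add: subst_monom_mult\<close>)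

lemma subst_monom_eval_fls: "c \<noteq> 0 \<Longrightarrow> n > 0 \<Longrightarrow> subst_monom c n (eval_fls P f) = eval_fls P (subst_monom c n f)"
  by (induction P) (use subst_monom_const[of c n 0] in \<open>simp_all add: subst_monom_mult subst_monom_add subst_monom_const\<close>)

lemma subst_monom_subst_monom:
  assumes "c \<noteq> 0" "n > 0" "d \<noteq> 0" "m > 0"
  shows "subst_monom c n (subst_monom d m f) = subst_monom (d * c ^ m) (n * m) f"
proof (rule fls_eqI)
  fix i
  have [simp]: "d * c ^ m \<noteq> 0" "n * m > 0" using assms by auto
  show "fls_nth (subst_monom c n (subst_monom d m f)) i = fls_nth (subst_monom (d * c ^ m) (n * m) f) i"
  proof (cases "int (n * m) dvd i")
    case True
    then obtain j where "i = int (n * m) * j" by (elim dvdE)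
    then have j: "i = int n * (int m * j)" by (simp add: mult.assoc)
    have "i div int n = int m * j" "i div int (n * m) = j"
      using assms by (simp_all add: j mult.assoc[symmetric])
    moreover have "c powi (int m * j) = (c ^ m) powi j" by (simp add: power_int_mult)
    ultimately show ?thesis
      using assms by (simp add: subst_monom_nth j power_int_mult_distrib)
  next
    case False
    have "\<not> (int n dvd i \<and> int m dvd i div int n)"
      using False assms by (auto elim!: dvdE simp: mult_ac)
    then show ?thesis using False assms by (auto simp: subst_monom_nth simp del: of_nat_mult)
  qed
qed

lemma subst_monom_nth_mult:
  assumes "c \<noteq> 0" "n > 0"
  shows "fls_nth (subst_monom c n f) (int n * j) = fls_nth f j * c powi j"
  using assms by (simp add: subst_monom_nth)

lemma subst_monom_inject:
  assumes "c \<noteq> 0" "n > 0" "subst_monom c n f = subst_monom c n g"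
  shows "f = g"
proof (rule fls_eqI)
  fix j
  show "fls_nth f j = fls_nth g j"
    using subst_monom_nth_mult[OF assms(1,2), of f j] subst_monom_nth_mult[OF assms(1,2), of g j] assms by simp
qed

lemma ord_ge_subst_monom:
  assumes "c \<noteq> 0" "n > 0" "ord_ge m f" "k \<le> int n * m"
  shows "ord_ge k (subst_monom c n f)"
  unfolding ord_ge_def
proof safe
  fix i assume "i < k"
  then have "i < int n * m" using assms by simp
  show "fls_nth (subst_monom c n f) i = 0"
  proof (cases "int n dvd i")
    case True
    then obtain j where j: "i = int n * j" by auto
    then have "j < m" using \<open>i < int n * m\<close> assms by simp
    then show ?thesis using assms by (simp add: j subst_monom_nth ord_geD[OF assms(3)])
  qed (use assms in \<open>simp add: subst_monom_nth\<close>)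
qed

lemma subdegree_subst_monom:
  assumes "c \<noteq> 0" "n > 0"
  shows "fls_subdegree (subst_monom c n f) = int n * fls_subdegree f"
proof (cases "f = 0")
  case True
  then show ?thesis using subst_monom_const[OF assms, of 0] by simp
next
  case False
  show ?thesis
  proof (rule fls_subdegree_eqI)
    show "fls_nth (subst_monom c n f) (int n * fls_subdegree f) \<noteq> 0"
      using False assms by (simp add: subst_monom_nth_mult)
    show "fls_nth (subst_monom c n f) i = 0" if "i < int n * fls_subdegree f" for i
      using ord_ge_subst_monom[OF assms ord_ge_subdegree order_refl, of f] that by (rule ord_geD)
  qed
qed

lemma subst_monom_X_inv_power:
  assumes "c \<noteq> 0" "n > 0"
  shows "subst_monom c n (fls_X_inv ^ k) = fls_const (c powi (- int k)) * fls_X_inv ^ (n * k)"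
proof (rule fls_eqI)
  fix i
  show "fls_nth (subst_monom c n (fls_X_inv ^ k)) i =
      fls_nth (fls_const (c powi (- int k)) * fls_X_inv ^ (n * k)) i"
  proof (cases "int n dvd i")
    case True
    then obtain j where j: "i = int n * j" by auto
    have "i = - int (n * k) \<longleftrightarrow> j = - int k"
      using assms by (simp add: j) (metis mult_cancel_left mult_minus_right of_nat_0_less_iff less_irrefl)
    then show ?thesis using assms by (auto simp: j subst_monom_nth)
  next
    case False
    then have "i \<noteq> - int (n * k)" by auto
    then show ?thesis using assms False by (simp add: subst_monom_nth)
  qed
qed

lemma ex_subst_monom_if_dvd:
  assumes "n > 0" "\<And>i. fls_nth f i \<noteq> 0 \<Longrightarrow> int n dvd i"
  shows "\<exists>g. f = subst_monom 1 n g"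
proof -
  define g where "g = Abs_fls (\<lambda>j. fls_nth f (int n * j))"
  have g: "fls_nth g j = fls_nth f (int n * j)" for j
    unfolding g_def
  proof (rule nth_Abs_fls_lower_bound)
    show "\<forall>j<min 0 (fls_subdegree f). fls_nth f (int n * j) = 0"
    proof safe
      fix j assume j: "j < min 0 (fls_subdegree f)"
      have "int n * j \<le> 1 * j" using j assms(1) by (intro mult_right_mono_neg) auto
      then have "int n * j < fls_subdegree f" using j by linarith
      then show "fls_nth f (int n * j) = 0" by (rule fls_eq0_below_subdegree)
    qed
  qed
  have "f = subst_monom 1 n g"
  proof (rule fls_eqI)
    fix i show "fls_nth f i = fls_nth (subst_monom 1 n g) i"
      using assms by (cases "int n dvd i") (auto simp: subst_monom_nth g)
  qed
  then show ?thesis ..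
qed

text \<open>The Euler operator \<open>w d/dw = - x d/dx\<close>. It never lowers the order in \<open>x\<close> and multiplies \<open>w^j\<close> by \<open>j\<close>.\<close>

definition euler :: "complex fls \<Rightarrow> complex fls" where
  "euler f = - (fls_X * fls_deriv f)"

lemma euler_nth: "fls_nth (euler f) i = - of_int i * fls_nth f i"
  by (simp add: euler_def fls_X_times_conv_shift)

lemma euler_add [simp]: "euler (f + g) = euler f + euler g"
  and euler_diff [simp]: "euler (f - g) = euler f - euler g"
  and euler_const [simp]: "euler (fls_const c) = 0"
  and euler_mult: "euler (f * g) = euler f * g + f * euler g"
  by (simp_all add: euler_def algebra_simps)

lemma euler_eval_fls: "euler (eval_fls P f) = eval_fls (pderiv P) f * euler f"
proof (induction P)
  case (pCons a P)
  then show ?case by (simp add: euler_mult pderiv_pCons algebra_simps)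
qed (simp add: euler_def)

lemma euler_subst_monom:
  assumes "c \<noteq> 0" "n > 0"
  shows "euler (subst_monom c n f) = of_nat n * subst_monom c n (euler f)"
  by (rule fls_eqI) (use assms in \<open>auto simp: euler_nth subst_monom_nth fls_of_nat elim!: dvdE\<close>)

lemma euler_X_power: "euler (fls_X ^ n) = - of_nat n * fls_X ^ n"
  by (rule fls_eqI) (auto simp: euler_nth fls_of_nat)

lemma euler_X_inv_power: "euler (fls_X_inv ^ n) = of_nat n * fls_X_inv ^ n"
  by (rule fls_eqI) (auto simp: euler_nth fls_of_nat)

lemma ord_ge_euler: "ord_ge m f \<Longrightarrow> ord_ge m (euler f)"
  by (simp add: ord_ge_def euler_nth)

lemma ord_ge_if_euler:
  assumes "ord_ge 1 f" "ord_ge m (euler f)"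
  shows "ord_ge m f"
  unfolding ord_ge_def
proof safe
  fix i assume "i < m"
  then show "fls_nth f i = 0"
    using assms by (cases "i < 1") (auto simp: ord_ge_def euler_nth)
qed

lemma subdegree_euler:
  assumes "fls_subdegree f = -1"
  shows "fls_subdegree (euler f) = -1"
proof (rule fls_subdegree_eqI)
  have "f \<noteq> 0" using assms by auto
  then show "fls_nth (euler f) (-1) \<noteq> 0"
    using nth_fls_subdegree_nonzero[of f] assms by (simp add: euler_nth)
qed (use assms in \<open>simp add: euler_nth\<close>)

section \<open>Boettcher series\<close>

lemma fls_nth_mult_at_bounds:
  assumes "ord_ge m f" "ord_ge k g" "j = m + k"
  shows "fls_nth (f * g) j = fls_nth f m * fls_nth g k"
proof (cases "f = 0 \<or> g = 0")
  case False
  then have "m \<le> fls_subdegree f" "k \<le> fls_subdegree g"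
    using assms by (auto simp: ord_ge_iff)
  then consider "m = fls_subdegree f" "k = fls_subdegree g" | "m < fls_subdegree f" | "k < fls_subdegree g"
    by linarith
  then show ?thesis
  proof cases
    case 1
    then show ?thesis using assms(3) by (simp add: fls_times_base)
  qed (use \<open>m \<le> _\<close> \<open>k \<le> _\<close> assms(3) in \<open>simp_all add: fls_times_nth_eq0\<close>)
qed auto

lemma eval_fls_at_bound:
  assumes f: "ord_ge (- int k) f" and k: "k > 0"
  shows "ord_ge (- int k * int (degree P)) (eval_fls P f) \<and>
    fls_nth (eval_fls P f) (- int k * int (degree P)) = lead_coeff P * fls_nth f (- int k) ^ degree P"
proof (induction P)
  case (pCons a P)
  show ?case
  proof (cases "P = 0")
    case False
    have e: "- int k * int (degree (pCons a P)) = - int k + - int k * int (degree P)"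
      using False by (simp add: algebra_simps)
    have neg: "- int k * int (degree (pCons a P)) < 0" using k False by simp
    have "ord_ge (- int k * int (degree (pCons a P))) (f * eval_fls P f)"
      by (rule ord_ge_mult[OF f conjunct1[OF pCons.IH] eq_refl[OF e]])
    moreover have "ord_ge (- int k * int (degree (pCons a P))) (fls_const a)"
      by (rule ord_ge_mono[OF ord_ge_const]) (use neg in simp)
    moreover have "fls_nth (f * eval_fls P f) (- int k * int (degree (pCons a P))) =
        fls_nth f (- int k) * (lead_coeff P * fls_nth f (- int k) ^ degree P)"
      using fls_nth_mult_at_bounds[OF f conjunct1[OF pCons.IH] e] pCons.IH by simp
    moreover have "fls_nth (fls_const a) (- int k * int (degree (pCons a P))) = 0"
      by (rule ord_geD[OF ord_ge_const neg])
    ultimately show ?thesis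
      using False by (simp add: ord_ge_add del: mult_minus_left)
  qed (simp add: ord_ge_const)
qed simp

text \<open>The quotient \<open>(A(y) - A(z)) / (y - z)\<close> at two series with a common leading term \<open>u w^k\<close>. Its leading
coefficient is that of \<open>A'\<close> at \<open>u w^k\<close>, which is what both Newton-like arguments below need.\<close>

lemma eval_fls_difference_quotient:
  assumes k: "k > 0" and f: "ord_ge (- int k) f" "fls_nth f (- int k) = u"
    and g: "ord_ge (- int k) g" "fls_nth g (- int k) = u"
  shows "\<exists>q. eval_fls A f - eval_fls A g = (f - g) * q \<and> ord_ge (- int k * (int (degree A) - 1)) q \<and>
    fls_nth q (- int k * (int (degree A) - 1)) = of_nat (degree A) * lead_coeff A * u ^ (degree A - 1)"
proof (induction A)
  case 0
  show ?case by (rule exI[of _ 0]) simp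
next
  case (pCons a P)
  show ?case
  proof (cases "P = 0")
    case True
    then show ?thesis by (intro exI[of _ 0]) simp
  next
    case False
    from pCons.IH obtain q where q: "eval_fls P f - eval_fls P g = (f - g) * q"
      "ord_ge (- int k * (int (degree P) - 1)) q"
      "fls_nth q (- int k * (int (degree P) - 1)) = of_nat (degree P) * lead_coeff P * u ^ (degree P - 1)"
      by blast
    note l = eval_fls_at_bound[OF f(1) k, of P]
    let ?d = "- int k * int (degree P)"
    have e: "?d = - int k + - int k * (int (degree P) - 1)" by (simp add: algebra_simps)
    have "eval_fls (pCons a P) f - eval_fls (pCons a P) g = (f - g) * eval_fls P f + g * (eval_fls P f - eval_fls P g)"
      by (simp add: algebra_simps)
    also have "\<dots> = (f - g) * (eval_fls P f + g * q)"
      by (simp add: q(1) algebra_simps)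
    finally have "eval_fls (pCons a P) f - eval_fls (pCons a P) g = (f - g) * (eval_fls P f + g * q)" .
    moreover have "ord_ge ?d (eval_fls P f + g * q)"
      by (rule ord_ge_add[OF conjunct1[OF l] ord_ge_mult[OF g(1) q(2) eq_refl[OF e]]])
    moreover have "fls_nth (eval_fls P f + g * q) ?d = of_nat (Suc (degree P)) * lead_coeff P * u ^ degree P"
    proof -
      have "fls_nth (g * q) ?d = u * (of_nat (degree P) * lead_coeff P * u ^ (degree P - 1))"
        using fls_nth_mult_at_bounds[OF g(1) q(2) e] g(2) q(3) by simp
      also have "\<dots> = of_nat (degree P) * lead_coeff P * u ^ degree P"
        by (cases "degree P") simp_all
      finally show ?thesis
        using conjunct2[OF l] f(2) by (simp add: algebra_simps)
    qed
    ultimately show ?thesis using False by (intro exI[of _ "eval_fls P f + g * q"]) simp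
  qed
qed

text \<open>The difference \<open>h\<close> of two solutions satisfies \<open>h(w^n) = h(w) q(w)\<close>, where \<open>q\<close> has a pole of order
\<open>k (n - 1)\<close>. Comparing orders, \<open>h\<close> would have a pole of order exactly \<open>k\<close>, but the leading terms cancel.\<close>

lemma bottcher_equation_unique:
  assumes "degree A = n" "n \<ge> 2" "k > 0" "u \<noteq> 0"
    and f: "ord_ge (- int k) f" "fls_nth f (- int k) = u" "eval_fls A f = subst_monom 1 n f"
    and g: "ord_ge (- int k) g" "fls_nth g (- int k) = u" "eval_fls A g = subst_monom 1 n g"
  shows "f = g"
proof (rule ccontr)
  assume "f \<noteq> g"
  define h where "h = f - g"
  have h0: "h \<noteq> 0" using \<open>f \<noteq> g\<close> by (simp add: h_def)
  obtain q where q: "eval_fls A f - eval_fls A g = h * q"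
      "ord_ge (- int k * (int n - 1)) q"
      "fls_nth q (- int k * (int n - 1)) = of_nat n * lead_coeff A * u ^ (n - 1)"
    using eval_fls_difference_quotient[OF \<open>k > 0\<close> f(1,2) g(1,2), of A] assms(1) by (auto simp: h_def)
  have "lead_coeff A \<noteq> 0" using assms(1,2) by auto
  then have qn: "fls_nth q (- int k * (int n - 1)) \<noteq> 0" using q(3) assms by simp
  then have sq: "fls_subdegree q = - int k * (int n - 1)"
    by (intro fls_subdegree_eqI) (use q(2) in \<open>auto simp: ord_ge_def\<close>)
  have "q \<noteq> 0" using qn by auto
  have "subst_monom 1 n h = h * q"
    using q(1) f(3) g(3) assms(2) by (simp add: h_def subst_monom_diff)
  then have "fls_subdegree (subst_monom 1 n h) = fls_subdegree h + fls_subdegree q"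
    using h0 \<open>q \<noteq> 0\<close> by simp
  then have "int n * fls_subdegree h = fls_subdegree h - int k * (int n - 1)"
    using assms(2) by (simp add: subdegree_subst_monom sq)
  then have "(int n - 1) * (fls_subdegree h + int k) = 0" by (simp add: algebra_simps)
  then have s: "fls_subdegree h = - int k" using assms(2) by auto
  have "fls_nth h (- int k) = 0" by (simp add: h_def f g)
  then show False using nth_fls_subdegree_nonzero[OF h0] s by simp
qed

text \<open>Successive approximation: changing \<open>f\<close> by \<open>b x^m\<close> changes the defect \<open>A(f(w)) - f(w^n)\<close> by
\<open>n b x^(m + 1 - n)\<close> up to higher order, so one coefficient \<open>b\<close> after the other can be chosen to raise the
order of the defect.\<close>

lemma ex_bottcher_series:
  assumes A: "degree A = n" "n \<ge> 2" and u: "u \<noteq> 0" "lead_coeff A * u ^ n = u"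
  shows "\<exists>f. fls_subdegree f = -1 \<and> fls_nth f (-1) = u \<and> eval_fls A f = subst_monom 1 n f"
proof -
  define E where "E f = eval_fls A f - subst_monom 1 n f" for f
  define start where "start f \<longleftrightarrow> ord_ge (-1) f \<and> fls_nth f (-1) = u" for f
  have "u ^ n = u * u ^ (n - 1)" using A(2) by (cases n) simp_all
  then have a: "lead_coeff A * u ^ (n - 1) = 1" using u by simp
  have pert: "ord_ge (int m + 1 - int n) (E g - E f) \<and>
      fls_nth (E g - E f) (int m + 1 - int n) = of_nat n * fls_nth (g - f) (int m)"
    if f: "start f" and g: "start g" and d: "ord_ge (int m) (g - f)" for m f g
  proof -
    obtain q where q: "eval_fls A g - eval_fls A f = (g - f) * q"
      "ord_ge (1 - int n) q"
      "fls_nth q (1 - int n) = of_nat n * lead_coeff A * u ^ (n - 1)"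
      using eval_fls_difference_quotient[of 1 g u f A] f g A(1) by (auto simp: start_def)
    have qn: "fls_nth q (1 - int n) = of_nat n" using q(3) a by (simp add: mult.assoc)
    have E: "E g - E f = (g - f) * q - subst_monom 1 n (g - f)"
      using A(2) q(1) by (simp add: E_def subst_monom_diff algebra_simps)
    have "int m \<le> int n * int m" using A(2) by (cases m) auto
    then have s: "ord_ge (int m) (subst_monom 1 n (g - f))"
      using A(2) d by (intro ord_ge_subst_monom) auto
    have "ord_ge (int m + 1 - int n) ((g - f) * q)"
      by (rule ord_ge_mult[OF d q(2)]) simp
    moreover have "ord_ge (int m + 1 - int n) (subst_monom 1 n (g - f))"
      by (rule ord_ge_mono[OF s]) (use A(2) in simp)
    moreover have "fls_nth ((g - f) * q) (int m + 1 - int n) = fls_nth (g - f) (int m) * of_nat n"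
      using fls_nth_mult_at_bounds[OF d q(2), of "int m + 1 - int n"] qn by simp
    moreover have "fls_nth (subst_monom 1 n (g - f)) (int m + 1 - int n) = 0"
      by (rule ord_geD[OF s]) (use A(2) in simp)
    ultimately show ?thesis by (simp add: E ord_ge_diff)
  qed
  define P where "P m f \<longleftrightarrow> start f \<and> ord_ge (int m + 1 - int n) (E f)" for m f
  have "\<exists>F. \<forall>m. P m (F m) \<and> ord_ge (int m) (F (Suc m) - F m)"
  proof (rule dependent_nat_choice)
    define f where "f = fls_const u * fls_X_inv"
    have f: "start f" by (simp add: start_def ord_ge_def f_def)
    have l: "ord_ge (- int n) (eval_fls A f)" "fls_nth (eval_fls A f) (- int n) = lead_coeff A * u ^ n"
      using eval_fls_at_bound[of 1 f A] f A(1) by (auto simp: start_def)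
    have s: "ord_ge (- int n) (subst_monom 1 n f)" "fls_nth (subst_monom 1 n f) (- int n) = u"
      using ord_ge_subst_monom[of 1 n "-1" f "- int n"] subst_monom_nth_mult[of 1 n f "-1"] f A(2)
      by (auto simp: start_def)
    have "ord_ge (1 - int n) (E f)"
      unfolding ord_ge_def E_def
    proof safe
      fix i assume "i < 1 - int n"
      then consider "i = - int n" | "i < - int n" by linarith
      then show "fls_nth (eval_fls A f - subst_monom 1 n f) i = 0"
        by cases (use l s u(2) in \<open>auto simp: ord_ge_def\<close>)
    qed
    then show "\<exists>f. P 0 f" using f by (auto simp: P_def)
  next
    fix f m assume Pf: "P m f"
    define b where "b = - fls_nth (E f) (int m + 1 - int n) / of_nat n"
    define g where "g = f + fls_const b * fls_X ^ m"
    have d: "ord_ge (int m) (g - f)" by (simp add: g_def ord_ge_def)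
    have f: "start f" using Pf by (simp add: P_def)
    then have g: "start g" by (simp add: start_def g_def ord_ge_def)
    note p = pert[OF f g d]
    have "ord_ge (int (Suc m) + 1 - int n) (E g)"
      unfolding ord_ge_def
    proof safe
      fix i assume "i < int (Suc m) + 1 - int n"
      then consider "i = int m + 1 - int n" | "i < int m + 1 - int n" by fastforce
      then show "fls_nth (E g) i = 0"
      proof cases
        case 1
        have "fls_nth (E g) i - fls_nth (E f) i = of_nat n * b"
          using p by (simp add: 1 g_def)
        then show ?thesis using A(2) by (simp add: b_def 1)
      next
        case 2
        have "fls_nth (E g) i - fls_nth (E f) i = 0"
          using ord_geD[OF conjunct1[OF p] 2] by simp
        moreover have "fls_nth (E f) i = 0" using Pf 2 by (auto simp: P_def ord_ge_def)
        ultimately show ?thesis by simp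
      qed
    qed
    then show "\<exists>g. P (Suc m) g \<and> ord_ge (int m) (g - f)" using d g by (auto simp: P_def)
  qed
  then obtain F where F: "\<And>m. P m (F m)" "\<And>m. ord_ge (int m) (F (Suc m) - F m)" by blast
  have mono: "ord_ge (int m) (F (m + j) - F m)" for m j
  proof (induction j)
    case (Suc j)
    have "ord_ge (int m) (F (Suc (m + j)) - F (m + j))"
      by (rule ord_ge_mono[OF F(2)]) simp
    from ord_ge_add[OF this Suc.IH] show ?case by simp
  qed simp
  \<comment> \<open>the coefficient of \<open>x^(j-1)\<close> no longer changes after step \<open>j\<close>\<close>
  define f where "f = fls_shift 1 (fps_to_fls (Abs_fps (\<lambda>j. fls_nth (F j) (int j - 1))))"
  have fn: "fls_nth f i = fls_nth (F m) i" if "i < int m" for i m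
  proof (cases "i < -1")
    case True
    then show ?thesis using F(1)[of m] by (auto simp: f_def P_def start_def ord_ge_def)
  next
    case False
    then have 1: "fls_nth f i = fls_nth (F (nat (i + 1))) i" by (simp add: f_def)
    have "fls_nth (F (nat (i + 1) + (m - nat (i + 1))) - F (nat (i + 1))) i = 0"
      by (rule ord_geD[OF mono]) (use False in simp)
    then show ?thesis using that False 1 by simp
  qed
  have d: "ord_ge (int m) (f - F m)" for m
    by (simp add: ord_ge_def fn)
  have sf: "start f"
    using F(1)[of 0] by (auto simp: start_def P_def ord_ge_def fn[of _ 0])
  have "ord_ge (int m + 1 - int n) (E f)" for m
    using ord_ge_add[OF conjunct1[OF pert[OF _ sf d[of m]]], of "E (F m)"] F(1)[of m]
    by (simp add: P_def)
  then have "ord_ge (int k) (E f)" for k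
    by (rule ord_ge_mono[of "int (k + n) + 1 - int n"]) simp
  then have "E f = 0" by (rule eq_0_if_ord_ge)
  moreover have "fls_subdegree f = -1"
    using sf u by (intro fls_subdegree_eqI) (auto simp: start_def ord_ge_def)
  ultimately show ?thesis using sf by (intro exI[of _ f]) (simp add: E_def start_def)
qed

section \<open>Polynomials with gaps at a series\<close>

text \<open>Here \<open>X\<close> and \<open>Y\<close> are polynomials of degrees \<open>k\<close> and \<open>l\<close> that act on the parameter \<open>w\<close> as monomials
and lead from \<open>f\<close> to the same series \<open>g\<close>. Semiconjugacies from \<open>B\<close> to \<open>A\<close> are the example, with Boettcher
series of \<open>B\<close> and \<open>A\<close> for \<open>f\<close> and \<open>g\<close>.\<close>

definition descends_twice :: "nat \<Rightarrow> nat \<Rightarrow> complex fls \<Rightarrow> complex fls \<Rightarrow> bool" where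
  "descends_twice k l f g \<longleftrightarrow> fls_subdegree f = -1 \<and> fls_subdegree g = -1 \<and>
    (\<exists>X Y c d. c \<noteq> 0 \<and> d \<noteq> 0 \<and> eval_fls X f = subst_monom c k g \<and> eval_fls Y f = subst_monom d l g)"

text \<open>Let \<open>P(g(w)) = (c w)^m + O(1/w)\<close>. The substitution \<open>w \<mapsto> w^k / c\<close> turns this into
\<open>P(X(f(w))) = w^(km) + O(1/w)\<close>, so \<open>P \<circ> X\<close> and \<open>H\<close> coincide.\<close>

lemma polynomial_part_factors:
  assumes f: "fls_subdegree f = -1" and g: "fls_subdegree g = -1"
    and c: "c \<noteq> 0" and k: "k > 0" and X: "eval_fls X f = subst_monom c k g"
    and H: "ord_ge 1 (eval_fls H f - fls_X_inv ^ (k * m))"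
  shows "\<exists>P. eval_fls H f = subst_monom c k (eval_fls P g)"
proof -
  obtain P where P: "ord_ge 1 (eval_fls P g - fls_const (c ^ m) * fls_X_inv ^ m)"
    using ex_polynomial_part[OF g] by blast
  have "subst_monom c k (fls_const (c ^ m) * fls_X_inv ^ m) =
      fls_const (c ^ m * c powi (- int m)) * fls_X_inv ^ (k * m)"
    by (simp only: subst_monom_mult[OF c k] subst_monom_const[OF c k] subst_monom_X_inv_power[OF c k] mult.assoc[symmetric] fls_const_mult_const)
  also have "\<dots> = fls_X_inv ^ (k * m)"
    using c by (simp add: power_int_minus)
  finally have s: "subst_monom c k (fls_const (c ^ m) * fls_X_inv ^ m) = fls_X_inv ^ (k * m)" .
  have "ord_ge 1 (subst_monom c k (eval_fls P g - fls_const (c ^ m) * fls_X_inv ^ m))"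
    using c k P by (rule ord_ge_subst_monom) (use k in simp)
  then have "ord_ge 1 (subst_monom c k (eval_fls P g) - fls_X_inv ^ (k * m))"
    by (simp add: subst_monom_diff[OF c k] s)
  moreover have XP: "subst_monom c k (eval_fls P g) = eval_fls (P \<circ>\<^sub>p X) f"
    by (simp add: subst_monom_eval_fls[OF c k] X)
  ultimately have "ord_ge 1 (eval_fls (P \<circ>\<^sub>p X - H) f)"
    using ord_ge_diff[OF _ H, of "subst_monom c k (eval_fls P g) - fls_X_inv ^ (k * m)"] by simp
  then have "P \<circ>\<^sub>p X = H" using eval_fls_eq_0_if_ord_ge_1[OF f] by (metis right_minus_eq)
  then show ?thesis using XP by metis
qed

text \<open>The polynomial \<open>H\<close> with \<open>H(f(w)) = w^(gkl) + O(1/w)\<close> factors through both given polynomials. Its value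
is therefore a series in \<open>w^(gk)\<close> and in \<open>w^(gl)\<close>, hence in \<open>w^(gkl)\<close>, and this common series is the
target \<open>s\<close> of both left factors.\<close>

lemma descends_twice_step:
  assumes "descends_twice (g * k) (g * l) f h" and pos: "g > 0" "k > 0" "l > 0" and "coprime k l"
  shows "\<exists>s. descends_twice l k h s"
proof -
  obtain X Y c d where f: "fls_subdegree f = -1" and h: "fls_subdegree h = -1"
    and c: "c \<noteq> 0" and d: "d \<noteq> 0"
    and X: "eval_fls X f = subst_monom c (g * k) h" and Y: "eval_fls Y f = subst_monom d (g * l) h"
    using assms(1) by (auto simp: descends_twice_def)
  have gk: "g * k > 0" and gl: "g * l > 0" and gkl: "g * k * l > 0" using pos by auto
  obtain H where H: "ord_ge 1 (eval_fls H f - fls_X_inv ^ (g * k * l))"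
    using ex_polynomial_part[OF f] by blast
  obtain P where P: "eval_fls H f = subst_monom c (g * k) (eval_fls P h)"
    using polynomial_part_factors[OF f h c gk X H] by blast
  have "ord_ge 1 (eval_fls H f - fls_X_inv ^ (g * l * k))"
    using H by (simp add: mult_ac)
  then obtain Q where Q: "eval_fls H f = subst_monom d (g * l) (eval_fls Q h)"
    using polynomial_part_factors[OF f h d gl Y] by blast
  have "int (g * k * l) dvd i" if "fls_nth (eval_fls H f) i \<noteq> 0" for i
  proof -
    have "int (g * k) dvd i"
      using that unfolding P by (auto simp: subst_monom_nth[OF c gk] split: if_splits)
    moreover have "int (g * l) dvd i"
      using that unfolding Q by (auto simp: subst_monom_nth[OF d gl] split: if_splits)
    moreover obtain j where j: "i = int g * j"
      using \<open>int (g * k) dvd i\<close> by (metis dvd_def dvd_mult_left of_nat_mult)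
    ultimately have "int k dvd j" "int l dvd j"
      using pos by simp_all
    then have "int k * int l dvd j" using \<open>coprime k l\<close> by (intro divides_mult) auto
    then show ?thesis using pos by (simp add: j mult.assoc)
  qed
  then obtain s where s: "eval_fls H f = subst_monom 1 (g * k * l) s"
    using ex_subst_monom_if_dvd[OF gkl] by blast
  have div: "eval_fls R h = subst_monom (1 / b ^ m) m s"
    if "b \<noteq> 0" "n > 0" "m > 0" "eval_fls H f = subst_monom b n (eval_fls R h)" "n * m = g * k * l" for b n m R
  proof (rule subst_monom_inject[OF that(1,2)])
    show "subst_monom b n (eval_fls R h) = subst_monom b n (subst_monom (1 / b ^ m) m s)"
      using that s by (simp add: subst_monom_subst_monom)
  qed
  have P': "eval_fls P h = subst_monom (1 / c ^ l) l s"
    by (rule div[OF c gk pos(3) P]) simp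
  have Q': "eval_fls Q h = subst_monom (1 / d ^ k) k s"
    by (rule div[OF d gl pos(2) Q]) (simp add: mult_ac)
  have "fls_subdegree s = -1"
  proof -
    have "int (g * k * l) * fls_subdegree s = fls_subdegree (eval_fls H f)"
      using s gkl by (simp add: subdegree_subst_monom)
    also have "\<dots> = - int (g * k * l)"
    proof (rule fls_subdegree_eqI)
      show "fls_nth (eval_fls H f) i = 0" if "i < - int (g * k * l)" for i
        using ord_geD[OF H, of i] that by (simp del: of_nat_mult)
      have "- int (g * k * l) < 1" by linarith
      from ord_geD[OF H this] show "fls_nth (eval_fls H f) (- int (g * k * l)) \<noteq> 0"
        by (simp del: of_nat_mult)
    qed
    finally have "int (g * k * l) * (fls_subdegree s + 1) = 0" by (simp add: algebra_simps)
    then show ?thesis using gkl by (simp del: of_nat_mult)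
  qed
  then have "descends_twice l k h s"
    unfolding descends_twice_def using h P' Q' c d
    by (intro conjI exI[of _ P] exI[of _ Q] exI[of _ "1 / c ^ l"] exI[of _ "1 / d ^ k"]) auto
  then show ?thesis ..
qed

definition gap_poly :: "nat \<Rightarrow> complex fls \<Rightarrow> complex poly \<Rightarrow> bool" where
  "gap_poly n f H \<longleftrightarrow> degree H = n \<and> (\<forall>i. fls_nth (eval_fls H f) i \<noteq> 0 \<longrightarrow> int n dvd i)"

lemma ex_gap_poly_mult:
  assumes "fls_subdegree f = -1" "fls_subdegree g = -1" "c \<noteq> 0" "k > 0" "eval_fls X f = subst_monom c k g"
    and "\<exists>H. gap_poly n g H"
  shows "\<exists>H. gap_poly (k * n) f H"
proof -
  from assms(6) obtain H where H: "gap_poly n g H" by blast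
  have e: "eval_fls (H \<circ>\<^sub>p X) f = subst_monom c k (eval_fls H g)" using assms by (simp add: subst_monom_eval_fls)
  have "int (degree X) = int k"
    using subdegree_eval_fls_simple_pole[OF assms(1), of X] subdegree_subst_monom[OF assms(3,4), of g] assms(2,5) by simp
  then have "degree (H \<circ>\<^sub>p X) = k * n" using H by (simp add: degree_pcompose gap_poly_def)
  moreover have "int (k * n) dvd i" if "fls_nth (eval_fls (H \<circ>\<^sub>p X) f) i \<noteq> 0" for i
  proof -
    from that have "int k dvd i" "fls_nth (eval_fls H g) (i div int k) \<noteq> 0"
      unfolding e using assms by (auto simp: subst_monom_nth split: if_splits)
    moreover from this obtain j where "i = int k * j" by auto
    ultimately show ?thesis using H assms(4) by (simp add: gap_poly_def)
  qed
  ultimately show ?thesis unfolding gap_poly_def by blast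
qed

text \<open>Every step of the tower offers one polynomial of degree \<open>k\<close> and one of degree \<open>l\<close>; a gap polynomial
for \<open>f\<close> arises by composing either of them with one for the next series. The roles of \<open>k\<close> and \<open>l\<close> are
exchanged at each step.\<close>

lemma ex_gap_poly_powers:
  assumes "descends_twice k l f g" "k > 0" "l > 0" "coprime k l"
  shows "\<exists>H. gap_poly (k ^ a * l ^ b) f H"
  using assms
proof (induction "a + b" arbitrary: a b k l f g)
  case 0
  have "gap_poly 1 f [:0, 1:]" by (simp add: gap_poly_def)
  then show ?case using 0 by auto
next
  case (Suc n)
  obtain s where s: "descends_twice (1 * l) (1 * k) g s"
    using descends_twice_step[of 1 k l f g] Suc.prems by auto
  obtain X Y c d where *: "fls_subdegree f = -1" "fls_subdegree g = -1" "c \<noteq> 0" "d \<noteq> 0"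
    "eval_fls X f = subst_monom c k g" "eval_fls Y f = subst_monom d l g"
    using Suc.prems by (auto simp: descends_twice_def)
  consider a' where "a = Suc a'" | b' where "b = Suc b'"
    using Suc.hyps(2) by (cases a; cases b) auto
  then show ?case
  proof cases
    case 1
    have "\<exists>H. gap_poly (l ^ b * k ^ a') g H"
      using Suc.hyps(1)[of b a' l k g s] Suc.hyps(2) s Suc.prems 1
      by (simp add: coprime_commute)
    from ex_gap_poly_mult[OF *(1-3) Suc.prems(2) *(5) this] show ?thesis
      by (simp add: 1 mult_ac)
  next
    case 2
    have "\<exists>H. gap_poly (l ^ b' * k ^ a) g H"
      using Suc.hyps(1)[of b' a l k g s] Suc.hyps(2) s Suc.prems 2
      by (simp add: coprime_commute)
    from ex_gap_poly_mult[OF *(1,2,4) Suc.prems(3) *(6) this] show ?thesis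
      by (simp add: 2 mult_ac)
  qed
qed

section \<open>Wronskians and rational approximants\<close>

text \<open>The exact analogue for a Chebyshev polynomial is \<open>T\<^sub>n\<close> with \<open>2 T\<^sub>n((w + 1/w)/2) = w^n + w^(-n)\<close>. A
power corresponds to \<open>e = 0\<close>.\<close>

definition normal_gap :: "nat \<Rightarrow> complex fls \<Rightarrow> complex poly \<Rightarrow> complex \<Rightarrow> bool" where
  "normal_gap n f H e \<longleftrightarrow> degree H = n \<and>
    ord_ge (2 * int n) (eval_fls H f - (fls_X_inv ^ n + fls_const e * fls_X ^ n))"

lemma ex_normal_gap:
  assumes f: "fls_subdegree f = -1" and n: "n > 0" and G: "gap_poly n f G"
  shows "\<exists>H e. normal_gap n f H e"
proof -
  define h where "h = fls_nth (eval_fls G f) (- int n)"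
  have deg: "degree G = n" using G by (simp add: gap_poly_def)
  then have "G \<noteq> 0" using n by auto
  then have h: "h \<noteq> 0"
    using subdegree_eval_fls[of f G] f deg nth_fls_subdegree_nonzero[of "eval_fls G f"] by (simp add: h_def)
  define H where "H = smult (1 / h) (G - [:fls_nth (eval_fls G f) 0:])"
  define e where "e = fls_nth (eval_fls G f) (int n) / h"
  have "ord_ge (2 * int n) (eval_fls H f - (fls_X_inv ^ n + fls_const e * fls_X ^ n))"
    unfolding ord_ge_def
  proof safe
    fix i assume i: "i < 2 * int n"
    show "fls_nth (eval_fls H f - (fls_X_inv ^ n + fls_const e * fls_X ^ n)) i = 0"
    proof (cases "int n dvd i")
      case False
      then have "i \<noteq> 0" "i \<noteq> int n" "i \<noteq> - int n" by auto
      moreover have "fls_nth (eval_fls G f) i = 0" using False G by (auto simp: gap_poly_def)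
      ultimately show ?thesis by (simp add: H_def)
    next
      case True
      then obtain j where j: "i = int n * j" by auto
      then have "j < 2" using i n by (simp add: mult.commute)
      then consider "j < -1" | "j = -1" | "j = 0" | "j = 1" by linarith
      then show ?thesis
      proof cases
        case 1
        have "int n * j < int n * (-1)" using 1 n by (intro mult_strict_left_mono) auto
        then have i': "i < - int n" by (simp add: j)
        then have "fls_nth (eval_fls G f) i = 0" using subdegree_eval_fls_simple_pole[OF f, of G] deg by simp
        then show ?thesis using i' by (simp add: H_def)
      qed (use n h in \<open>simp_all add: j H_def h_def[symmetric] e_def\<close>)
    qed
  qed
  moreover have "degree H = n"
  proof -
    have "degree (G - [:fls_nth (eval_fls G f) 0:]) = n"
      using degree_add_eq_left[of "- [:fls_nth (eval_fls G f) 0:]" G] deg n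
      by (simp only: diff_conv_add_uminus) simp
    then show ?thesis using h by (simp add: H_def)
  qed
  ultimately show ?thesis by (auto simp: normal_gap_def)
qed

lemma X_inv_power_mult_X_power:
  assumes "m \<ge> n"
  shows "fls_X_inv ^ m * fls_X ^ n = (fls_X_inv ^ (m - n) :: complex fls)"
    and "fls_X ^ m * fls_X_inv ^ n = (fls_X ^ (m - n) :: complex fls)"
proof -
  obtain j where m: "m = j + n" using assms by (metis le_add_diff_inverse2)
  have "fls_X_inv * fls_X = (1 :: complex fls)"
    by (metis fls_inverse_X fls_X_nonzero left_inverse)
  then have "fls_X_inv ^ n * fls_X ^ n = (1 :: complex fls)"
    by (metis power_mult_distrib power_one)
  then show "fls_X_inv ^ m * fls_X ^ n = (fls_X_inv ^ (m - n) :: complex fls)"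
    and "fls_X ^ m * fls_X_inv ^ n = (fls_X ^ (m - n) :: complex fls)"
    by (simp_all add: m power_add mult.assoc) (simp add: mult.commute)
qed

lemma normal_gap_expand:
  assumes "normal_gap n f H e"
  obtains r where "eval_fls H f = fls_X_inv ^ n + fls_const e * fls_X ^ n + r"
    and "euler (eval_fls H f) = fls_const (of_nat n) * (fls_X_inv ^ n - fls_const e * fls_X ^ n) + euler r"
    and "ord_ge (2 * int n) r"
proof
  let ?r = "eval_fls H f - (fls_X_inv ^ n + fls_const e * fls_X ^ n)"
  show "ord_ge (2 * int n) ?r" using assms by (simp add: normal_gap_def)
  show "eval_fls H f = fls_X_inv ^ n + fls_const e * fls_X ^ n + ?r" by simp
  show "euler (eval_fls H f) = fls_const (of_nat n) * (fls_X_inv ^ n - fls_const e * fls_X ^ n) + euler ?r"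
    by (simp add: euler_mult euler_X_power euler_X_inv_power fls_of_nat algebra_simps)
qed

text \<open>With \<open>H\<close> and \<open>M\<close> in the role of cosines of multiple angles and the Euler operator in that of a
derivative, this is the sine of the difference of the angles.\<close>

definition gap_wronskian :: "complex poly \<Rightarrow> complex poly \<Rightarrow> complex poly" where
  "gap_wronskian H M = smult (of_nat (degree H)) (H * pderiv M) - smult (of_nat (degree M)) (M * pderiv H)"

text \<open>Only the products of leading terms survive: \<open>w^L w^(-K) = w^J\<close> and \<open>w^K w^(-L) = w^(-J)\<close>, while
the terms \<open>w^(K+L)\<close> and \<open>w^(-K-L)\<close> cancel. The largest error is \<open>w^L O(w^(-2K))\<close>.\<close>

lemma gap_wronskian_expand:
  assumes H: "normal_gap K f H a" and M: "normal_gap L f M b"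
    and K: "0 < K" "K < L" "L = K + J"
  shows "ord_ge (int K - int J) (eval_fls (gap_wronskian H M) f * euler f -
    fls_const (2 * of_nat K * of_nat L) * (fls_const a * fls_X_inv ^ J - fls_const b * fls_X ^ J))"
proof -
  obtain r where r: "eval_fls H f = fls_X_inv ^ K + fls_const a * fls_X ^ K + r"
    "euler (eval_fls H f) = fls_const (of_nat K) * (fls_X_inv ^ K - fls_const a * fls_X ^ K) + euler r"
    "ord_ge (2 * int K) r" using normal_gap_expand[OF H] .
  obtain s where s: "eval_fls M f = fls_X_inv ^ L + fls_const b * fls_X ^ L + s"
    "euler (eval_fls M f) = fls_const (of_nat L) * (fls_X_inv ^ L - fls_const b * fls_X ^ L) + euler s"
    "ord_ge (2 * int L) s" using normal_gap_expand[OF M] .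
  define k l A B where "k = fls_const (of_nat K :: complex)" and "l = fls_const (of_nat L :: complex)"
    and "A = fls_const a" and "B = fls_const b"
  have J: "fls_X_inv ^ L * fls_X ^ K = (fls_X_inv ^ J :: complex fls)"
    "fls_X ^ L * fls_X_inv ^ K = (fls_X ^ J :: complex fls)"
    using X_inv_power_mult_X_power[of K L] K by simp_all
  define R where "R = k * l * r * (fls_X_inv ^ L - B * fls_X ^ L) + k * eval_fls H f * euler s
    - k * l * s * (fls_X_inv ^ K - A * fls_X ^ K) - l * eval_fls M f * euler r"
  have deg: "degree H = K" "degree M = L" using H M by (simp_all add: normal_gap_def)
  have "eval_fls (gap_wronskian H M) f * euler f = k * eval_fls H f * euler (eval_fls M f) - l * eval_fls M f * euler (eval_fls H f)"
    by (simp add: gap_wronskian_def deg euler_eval_fls k_def l_def algebra_simps)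
  also have "\<dots> = 2 * k * l * (A * (fls_X_inv ^ L * fls_X ^ K) - B * (fls_X ^ L * fls_X_inv ^ K)) + R"
    unfolding R_def r(2) s(2) unfolding r(1) s(1) k_def[symmetric] l_def[symmetric] A_def[symmetric] B_def[symmetric]
    by (simp add: algebra_simps)
  also have "\<dots> = fls_const (2 * of_nat K * of_nat L) * (A * fls_X_inv ^ J - B * fls_X ^ J) + R"
    unfolding J by (simp add: k_def l_def fls_const_mult_const[symmetric] del: fls_const_mult_const)
  finally have "eval_fls (gap_wronskian H M) f * euler f -
      fls_const (2 * of_nat K * of_nat L) * (A * fls_X_inv ^ J - B * fls_X ^ J) = R" by simp
  moreover have "ord_ge (int K - int J) R"
  proof -
    have c: "ord_ge 0 (k * l)" "ord_ge 0 k" "ord_ge 0 l"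
      unfolding k_def l_def by (simp_all add: ord_ge_def)
    have z: "ord_ge (- int n) (fls_X_inv ^ n - fls_const c * fls_X ^ n)" for n c
      by (simp add: ord_ge_def)
    have H0: "ord_ge (- int K) (eval_fls H f)" and M0: "ord_ge (- int L) (eval_fls M f)"
      unfolding r(1) s(1) using r(3) s(3) by (auto simp: ord_ge_def)
    have ts: "ord_ge (2 * int L) (euler s)" and tr: "ord_ge (2 * int K) (euler r)"
      using s(3) r(3) by (simp_all add: ord_ge_euler)
    have "ord_ge (int K - int J) (k * l * r * (fls_X_inv ^ L - B * fls_X ^ L))"
      unfolding B_def by (rule ord_ge_mult[OF ord_ge_mult[OF c(1) r(3) order_refl] z]) (use K in simp)
    moreover have "ord_ge (int K - int J) (k * eval_fls H f * euler s)"
      by (rule ord_ge_mult[OF ord_ge_mult[OF c(2) H0 order_refl] ts]) (use K in simp)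
    moreover have "ord_ge (int K - int J) (k * l * s * (fls_X_inv ^ K - A * fls_X ^ K))"
      unfolding A_def by (rule ord_ge_mult[OF ord_ge_mult[OF c(1) s(3) order_refl] z]) (use K in simp)
    moreover have "ord_ge (int K - int J) (l * eval_fls M f * euler r)"
      by (rule ord_ge_mult[OF ord_ge_mult[OF c(3) M0 order_refl] tr]) (use K in simp)
    ultimately show ?thesis unfolding R_def by (intro ord_ge_add ord_ge_diff)
  qed
  ultimately show ?thesis by (simp add: A_def B_def)
qed

text \<open>When \<open>H\<close> behaves like a power, the Wronskian has no pole left and vanishes; then \<open>M\<close> behaves like a
power as well.\<close>

lemma gap_wronskian_degenerate:
  assumes f: "fls_subdegree f = -1" and H: "normal_gap K f H 0" and M: "normal_gap L f M b"
    and K: "0 < K" "K < L" "L = K + J" "2 * J < K"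
  shows "b = 0" "gap_wronskian H M = 0"
proof -
  note w = gap_wronskian_expand[OF H M K(1-3)]
  let ?c = "2 * of_nat K * of_nat L * b :: complex"
  have w': "ord_ge (int K - int J) (eval_fls (gap_wronskian H M) f * euler f + fls_const ?c * fls_X ^ J)"
  proof -
    have "fls_const (2 * of_nat K * of_nat L) * (fls_const 0 * fls_X_inv ^ J - fls_const b * fls_X ^ J)
        = - (fls_const ?c * fls_X ^ J)"
      unfolding fls_const_mult_const[symmetric] by (simp add: mult_ac)
    with w show ?thesis by (simp only: diff_minus_eq_add)
  qed
  have t: "fls_subdegree (euler f) = -1" by (rule subdegree_euler[OF f])
  then have t0: "euler f \<noteq> 0" by auto
  have "ord_ge (int J) (eval_fls (gap_wronskian H M) f * euler f + fls_const ?c * fls_X ^ J)"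
    by (rule ord_ge_mono[OF w']) (use K in simp)
  moreover have "ord_ge (int J) (fls_const ?c * fls_X ^ J)"
    by (simp add: ord_ge_def)
  ultimately have "ord_ge (int J) (eval_fls (gap_wronskian H M) f * euler f)"
    using ord_ge_diff by fastforce
  then have "ord_ge (int J - (-1)) (eval_fls (gap_wronskian H M) f)"
    by (rule ord_ge_cancel) (use t t0 in simp_all)
  then have "ord_ge 1 (eval_fls (gap_wronskian H M) f)"
    by (rule ord_ge_mono) simp
  then show W: "gap_wronskian H M = 0" by (rule eval_fls_eq_0_if_ord_ge_1[OF f])
  have "fls_nth (fls_const ?c * fls_X ^ J) (int J) = 0"
    using ord_geD[OF w', of "int J"] K by (simp add: W)
  then show "b = 0" using K(1,2) by simp
qed

text \<open>Let \<open>G\<close> have the polynomial part \<open>\<alpha> w^J\<close>, with \<open>\<alpha>\<close> chosen to make \<open>G'\<close> the Wronskian \<open>D\<close>.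
The expansion of \<open>D\<close> then determines \<open>w d/dw\<close> of \<open>G(f(w))\<close>, and integrating it gives
\<open>G(f(w)) = \<alpha> w^J + \<beta> w^(-J) + O(w^(J-K))\<close>. The approximant comes from the identity
\<open>(\<alpha> w^J - \<beta> w^(-J))\<^sup>2 = (\<alpha> w^J + \<beta> w^(-J))\<^sup>2 - 4 \<alpha> \<beta>\<close>.\<close>

lemma chebyshev_like_approximant:
  assumes f: "fls_subdegree f = -1" and H: "normal_gap K f H a" and M: "normal_gap L f M b"
    and K: "0 < K" "K < L" "L = K + J" "2 * J < K" and a: "a \<noteq> 0"
  shows "\<exists>p q. q \<noteq> 0 \<and> degree q \<le> 2 * J \<and>
    ord_ge (int K - 2 * int J) (eval_fls q f * euler f ^ 2 - eval_fls p f)"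
proof -
  define D where "D = gap_wronskian H M"
  have J: "J > 0" using K by simp
  define \<alpha> \<beta> where "\<alpha> = 2 * of_nat K * of_nat L * a / of_nat J"
    and "\<beta> = 2 * of_nat K * of_nat L * b / of_nat J"
  define j where "j = fls_const (of_nat J :: complex)"
  define A B where "A = fls_const \<alpha>" and "B = fls_const \<beta>"
  define W Z :: "complex fls" where "W = fls_X_inv ^ J" and "Z = fls_X ^ J"
  have jA: "j * A = fls_const (2 * of_nat K * of_nat L) * fls_const a"
    "j * B = fls_const (2 * of_nat K * of_nat L) * fls_const b"
    using J by (simp_all add: j_def A_def B_def \<alpha>_def \<beta>_def)
  have "ord_ge (int K - int J) (eval_fls D f * euler f -
      fls_const (2 * of_nat K * of_nat L) * (fls_const a * W - fls_const b * Z))"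
    unfolding D_def W_def Z_def by (rule gap_wronskian_expand[OF H M K(1-3)])
  then have w: "ord_ge (int K - int J) (eval_fls D f * euler f - j * (A * W - B * Z))"
    unfolding right_diff_distrib mult.assoc[symmetric] jA .
  have t: "fls_subdegree (euler f) = -1" by (rule subdegree_euler[OF f])
  then have t0: "euler f \<noteq> 0" by auto
  have Zo: "ord_ge (int J) Z" and Wo: "ord_ge (- int J) W"
    by (simp_all add: Z_def W_def ord_ge_def)
  have thW: "euler (A * W) = j * (A * W)" and thZ: "euler (B * Z) = - (j * (B * Z))"
    by (simp_all add: A_def B_def W_def Z_def euler_mult euler_X_power euler_X_inv_power fls_of_nat j_def algebra_simps)
  obtain G where G: "ord_ge 1 (eval_fls G f - A * W)"
    using ex_polynomial_part[OF f] by blast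
  have "ord_ge 1 (euler (eval_fls G f - A * W))" using G by (rule ord_ge_euler)
  then have G1: "ord_ge 1 (eval_fls (pderiv G) f * euler f - j * (A * W))"
    by (simp add: euler_eval_fls thW)
  have "ord_ge 1 (eval_fls D f * euler f - j * (A * W))"
  proof -
    have "ord_ge 1 (eval_fls D f * euler f - j * (A * W - B * Z))"
      by (rule ord_ge_mono[OF w]) (use K in simp)
    moreover have "ord_ge 1 (j * (B * Z))"
    proof -
      have "ord_ge 0 (j * B)" by (simp add: j_def B_def ord_ge_def)
      from ord_ge_mult[OF this Zo, of 1] J show ?thesis by (simp add: mult.assoc)
    qed
    ultimately have "ord_ge 1 (eval_fls D f * euler f - j * (A * W - B * Z) - j * (B * Z))"
      by (rule ord_ge_diff)
    then show ?thesis by (simp add: algebra_simps)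
  qed
  from ord_ge_diff[OF G1 this] have "ord_ge 1 (eval_fls (pderiv G - D) f * euler f)"
    by (simp add: algebra_simps)
  then have "ord_ge (1 - (-1)) (eval_fls (pderiv G - D) f)"
    by (rule ord_ge_cancel) (use t t0 in simp_all)
  then have "ord_ge 1 (eval_fls (pderiv G - D) f)" by (rule ord_ge_mono) simp
  then have "pderiv G - D = 0" by (rule eval_fls_eq_0_if_ord_ge_1[OF f])
  then have GD: "pderiv G = D" by simp
  define s where "s = eval_fls G f - (A * W + B * Z)"
  have ths: "euler s = eval_fls D f * euler f - j * (A * W - B * Z)"
    by (simp add: s_def euler_eval_fls thW thZ GD algebra_simps)
  have s1: "ord_ge 1 s"
  proof -
    have "ord_ge 0 B" by (simp add: B_def ord_ge_const)
    from ord_ge_diff[OF G ord_ge_mult[OF this Zo, of 1]] J show ?thesis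
      by (simp add: s_def algebra_simps)
  qed
  have so: "ord_ge (int K - int J) s"
    by (rule ord_ge_if_euler[OF s1]) (use w in \<open>simp add: ths\<close>)
  define p where "p = smult (of_nat J ^ 2) (G ^ 2 - [:4 * \<alpha> * \<beta>:])"
  define q where "q = pderiv G ^ 2"
  have tho: "ord_ge (int K - int J) (euler s)" using so by (rule ord_ge_euler)
  have WZ: "W * Z = 1"
    unfolding W_def Z_def by (simp add: X_inv_power_mult_X_power)
  have pe: "eval_fls p f = j\<^sup>2 * ((A * W + B * Z + s)\<^sup>2 - 4 * A * B)"
    unfolding p_def s_def
    by (simp add: j_def A_def B_def fls_const_power fls_const_mult_const[symmetric] del: fls_const_mult_const)
  have qe: "eval_fls q f * euler f ^ 2 = (j * (A * W - B * Z) + euler s)\<^sup>2"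
    unfolding q_def ths by (simp add: GD power_mult_distrib)
  have "eval_fls q f * euler f ^ 2 - eval_fls p f =
      2 * j * (A * W - B * Z) * euler s + euler s * euler s - j * j * (2 * (A * W + B * Z) * s + s * s)
      - 4 * j * j * A * B * (W * Z - 1)"
    unfolding pe qe by (simp add: power2_eq_square algebra_simps)
  then have "eval_fls q f * euler f ^ 2 - eval_fls p f =
      2 * j * (A * W - B * Z) * euler s + euler s * euler s - j * j * (2 * (A * W + B * Z) * s + s * s)"
    by (simp add: WZ)
  moreover have "ord_ge (int K - 2 * int J) \<dots>"
  proof -
    have U: "ord_ge (- int J) (2 * j * (A * W - B * Z))" "ord_ge (- int J) (2 * (A * W + B * Z))"
      "ord_ge 0 (j * j)"
      by (simp_all add: j_def A_def B_def W_def Z_def ord_ge_def fls_times_nth_eq0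
          algebra_simps fls_const_numeral[symmetric] del: fls_const_numeral)
    have "ord_ge (int K - 2 * int J) (2 * j * (A * W - B * Z) * euler s)"
      by (rule ord_ge_mult[OF U(1) tho]) simp
    moreover have "ord_ge (int K - 2 * int J) (euler s * euler s)"
      by (rule ord_ge_mult[OF tho tho]) (use K in simp)
    moreover have "ord_ge (int K - 2 * int J) (j * j * (2 * (A * W + B * Z) * s + s * s))"
    proof (rule ord_ge_mult[OF U(3)])
      show "ord_ge (int K - 2 * int J) (2 * (A * W + B * Z) * s + s * s)"
        by (intro ord_ge_add ord_ge_mult[OF U(2) so] ord_ge_mult[OF so so]) (use K in simp_all)
    qed simp
    ultimately show ?thesis by (intro ord_ge_add ord_ge_diff)
  qed
  ultimately have main: "ord_ge (int K - 2 * int J) (eval_fls q f * euler f ^ 2 - eval_fls p f)" by simp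
  have nth: "fls_nth (eval_fls G f) i = fls_nth (A * W) i" if "i < 1" for i
    using ord_geD[OF G that] by simp
  have "\<alpha> \<noteq> 0" using a K(1,2) J by (simp add: \<alpha>_def)
  then have "fls_subdegree (eval_fls G f) = - int J"
    using J by (intro fls_subdegree_eqI) (simp_all add: nth A_def W_def)
  then have dG: "degree G = J" using subdegree_eval_fls_simple_pole[OF f, of G] by simp
  then have "q \<noteq> 0" using J by (simp add: q_def pderiv_eq_0_iff)
  moreover have "degree q \<le> 2 * J"
    using degree_power_le[of "pderiv G" 2] degree_pderiv[of G] dG by (simp add: q_def)
  ultimately show ?thesis using main by blast
qed

section \<open>Rationality of the squared Euler derivative\<close>

lemma ln_ratio_irrational:
  assumes k: "k \<ge> 2" and l: "l \<ge> (2::nat)" and "coprime k l"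
  shows "ln (real k) / ln (real l) \<notin> \<rat>"
proof
  assume "ln (real k) / ln (real l) \<in> \<rat>"
  then obtain m n where n: "n \<noteq> 0" and q: "\<bar>ln (real k) / ln (real l)\<bar> = real m / real n"
    using Rats_abs_nat_div_natE by blast
  have pos: "ln (real k) > 0" "ln (real l) > 0" using k l by simp_all
  then have "real n * ln (real k) = real m * ln (real l)"
    using q n by (simp add: field_simps)
  then have "ln (real k ^ n) = ln (real l ^ m)" using k l by (simp add: ln_realpow)
  then have "real k ^ n = real l ^ m" using k l by (subst (asm) ln_inj_iff) simp_all
  then have e: "k ^ n = l ^ m" by (metis of_nat_eq_iff of_nat_power)
  have "coprime (k ^ n) (l ^ m)" using assms(3) by simp
  then have "k ^ n = 1" using e by simp
  then show False using k n by (metis One_nat_def nat_power_eq_Suc_0_iff not_less_eq_eq numeral_2_eq_2 order_refl)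
qed

text \<open>Kronecker's theorem for \<open>\<theta> = log k / log l\<close>: some multiple of \<open>\<theta>\<close> lies slightly above an integer,
and some multiple slightly below.\<close>

lemma ex_close_powers:
  assumes "k \<ge> 2" "l \<ge> (2::nat)" "coprime k l"
  shows "\<exists>a b. l ^ b < k ^ a \<and> 8 * k ^ a \<le> 9 * l ^ b"
    and "\<exists>a b. k ^ a < l ^ b \<and> 8 * l ^ b \<le> 9 * k ^ a"
proof -
  define \<theta> where "\<theta> = ln (real k) / ln (real l)"
  have irr: "\<theta> \<notin> \<rat>" unfolding \<theta>_def by (rule ln_ratio_irrational[OF assms])
  have pos: "ln (real k) > 0" "ln (real l) > 0" using assms by simp_all
  define \<delta> where "\<delta> = ln (9/8) / ln (real l)"
  have \<delta>: "\<delta> > 0" using pos by (simp add: \<delta>_def)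
  have \<theta>0: "\<theta> > 0" using pos by (simp add: \<theta>_def)
  have ln_l: "\<theta> * ln (real l) = ln (real k)" "\<delta> * ln (real l) = ln (9/8)"
    using pos by (simp_all add: \<theta>_def \<delta>_def)
  have frac0: "frac (real n * \<theta>) \<noteq> 0" if "n > 0" for n
  proof
    assume "frac (real n * \<theta>) = 0"
    then have "real n * \<theta> \<in> \<int>" by (simp add: frac_eq_0_iff)
    then have "real n * \<theta> / real n \<in> \<rat>" by (intro Rats_divide) (auto elim: Ints_cases)
    then show False using irr that by simp
  qed
  have compare: "real x ^ a < real y ^ b \<and> 8 * real y ^ b \<le> 9 * real x ^ a"
    if "x \<ge> 2" "y \<ge> 2" "0 < real b * ln (real y) - real a * ln (real x)"
      "real b * ln (real y) - real a * ln (real x) < ln (9/8)" for x y a b :: nat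
  proof -
    have e: "real b * ln (real y) - real a * ln (real x) = ln (real y ^ b / real x ^ a)"
      using that(1,2) by (simp add: ln_div ln_realpow)
    have p: "real y ^ b / real x ^ a > 0" using that(1,2) by simp
    have "1 < real y ^ b / real x ^ a" using that(3) p unfolding e by simp
    moreover have "real y ^ b / real x ^ a < 9/8" using that(4) p unfolding e by simp
    ultimately show ?thesis using that(1,2) by (simp add: field_simps)
  qed
  obtain n where n: "n > 0" "\<bar>frac (real n * \<theta>) - 0\<bar> < \<delta>"
    using Kronecker_approx_1_explicit[OF irr, of 0 \<delta>] \<delta> by auto
  define m where "m = nat \<lfloor>real n * \<theta>\<rfloor>"
  have "real m = real n * \<theta> - frac (real n * \<theta>)"
    using \<theta>0 by (simp add: m_def frac_def)
  moreover have "0 < frac (real n * \<theta>)" "frac (real n * \<theta>) < \<delta>"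
    using n frac0[of n] frac_ge_0[of "real n * \<theta>"] by linarith+
  ultimately have "0 < real n * \<theta> - real m" "real n * \<theta> - real m < \<delta>" by linarith+
  then have "0 < (real n * \<theta> - real m) * ln (real l)" "(real n * \<theta> - real m) * ln (real l) < \<delta> * ln (real l)"
    using pos by simp_all
  then have "0 < real n * ln (real k) - real m * ln (real l)" "real n * ln (real k) - real m * ln (real l) < ln (9/8)"
    by (simp_all add: left_diff_distrib mult.assoc ln_l)
  from compare[OF assms(2,1) this] have "real (l ^ m) < real (k ^ n) \<and> real (8 * k ^ n) \<le> real (9 * l ^ m)" by simp
  then show "\<exists>a b. l ^ b < k ^ a \<and> 8 * k ^ a \<le> 9 * l ^ b"
    unfolding of_nat_less_iff of_nat_le_iff by blast
  obtain n where n: "n > 0" "\<bar>frac (real n * \<theta>) - 1\<bar> < \<delta>"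
    using Kronecker_approx_1_explicit[OF irr, of 1 \<delta>] \<delta> by auto
  define m where "m = nat \<lfloor>real n * \<theta>\<rfloor> + 1"
  have "real m = real n * \<theta> - frac (real n * \<theta>) + 1"
    using \<theta>0 by (simp add: m_def frac_def)
  moreover have "frac (real n * \<theta>) < 1" "1 - frac (real n * \<theta>) < \<delta>"
    using n frac_lt_1[of "real n * \<theta>"] by linarith+
  ultimately have "0 < real m - real n * \<theta>" "real m - real n * \<theta> < \<delta>" by linarith+
  then have "0 < (real m - real n * \<theta>) * ln (real l)" "(real m - real n * \<theta>) * ln (real l) < \<delta> * ln (real l)"
    using pos by simp_all
  then have "0 < real m * ln (real l) - real n * ln (real k)" "real m * ln (real l) - real n * ln (real k) < ln (9/8)"
    by (simp_all add: left_diff_distrib mult.assoc ln_l)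
  from compare[OF assms(1,2) this] have "real (k ^ n) < real (l ^ m) \<and> real (8 * l ^ m) \<le> real (9 * k ^ n)" by simp
  then show "\<exists>a b. k ^ a < l ^ b \<and> 8 * l ^ b \<le> 9 * k ^ a"
    unfolding of_nat_less_iff of_nat_le_iff by blast
qed

text \<open>Multiplying by \<open>k^a / l^b\<close> or by \<open>l^d / k^c\<close>, both slightly larger than \<open>1\<close>, leads from one member
to the next. Beyond \<open>k^c l^b\<close>, one of the two divisions is always possible.\<close>

lemma ex_dense_chain:
  assumes "k \<ge> 2" "l \<ge> (2::nat)" "coprime k l"
  shows "\<exists>s :: nat \<Rightarrow> nat. \<forall>i. (\<exists>a b. s i = k ^ a * l ^ b) \<and> s i < s (Suc i) \<and> 8 * s (Suc i) \<le> 9 * s i"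
proof -
  obtain a b where ab: "l ^ b < k ^ a" "8 * k ^ a \<le> 9 * l ^ b"
    using ex_close_powers(1)[OF assms] by blast
  obtain c d where cd: "k ^ c < l ^ d" "8 * l ^ d \<le> 9 * k ^ c"
    using ex_close_powers(2)[OF assms] by blast
  \<comment> \<open>the lower bound guarantees that the next division is possible\<close>
  define P where "P s \<longleftrightarrow> k ^ c * l ^ b \<le> s \<and> (\<exists>i j. s = k ^ i * l ^ j)" for s
  have "\<exists>s. \<forall>n. P (s n) \<and> (s n < s (Suc n) \<and> 8 * s (Suc n) \<le> 9 * s n)"
  proof (rule dependent_nat_choice)
    show "\<exists>x. P x" unfolding P_def by blast
  next
    fix x :: nat and n :: nat assume "P x"
    then obtain i j where x: "x = k ^ i * l ^ j" and large: "k ^ c * l ^ b \<le> x"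
      by (auto simp: P_def)
    have x0: "x > 0" using x assms by simp
    have step: "P y \<and> x < y \<and> 8 * y \<le> 9 * x"
      if y: "y = k ^ i' * l ^ j'" and e: "y * u = x * v" and uv: "u < v" "8 * v \<le> 9 * u" for y i' j' u v
    proof -
      have "x * u < x * v" using x0 uv by simp
      then have xy: "x < y" unfolding e[symmetric] by (metis mult_less_cancel2)
      have "u > 0" using uv by (cases u) auto
      have "8 * y * u \<le> 9 * x * u" using e uv(2) by (metis mult.assoc mult.left_commute mult_le_mono2)
      then have "8 * y \<le> 9 * x" using \<open>u > 0\<close> by simp
      with xy y large show ?thesis unfolding P_def by (intro conjI) auto
    qed
    show "\<exists>y. P y \<and> (x < y \<and> 8 * y \<le> 9 * x)"
    proof (cases "b \<le> j")
      case True
      have "(k ^ (i + a) * l ^ (j - b)) * l ^ b = x * k ^ a"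
        using True by (simp add: x power_add mult.assoc mult.left_commute) (simp add: power_add[symmetric])
      from step[OF refl this ab] show ?thesis by blast
    next
      case False
      have "c \<le> i"
      proof (rule ccontr)
        assume "\<not> c \<le> i"
        then have "k ^ i < k ^ c" "l ^ j < l ^ b"
          using False assms by (auto intro!: power_strict_increasing)
        then have "x < k ^ c * l ^ b" unfolding x by (intro mult_strict_mono) (use assms in auto)
        with large show False by simp
      qed
      then have "(k ^ (i - c) * l ^ (j + d)) * k ^ c = x * l ^ d"
        by (simp add: x power_add mult_ac) (simp add: power_add[symmetric] mult.assoc[symmetric])
      from step[OF refl this cd] show ?thesis by blast
    qed
  qed
  then show ?thesis unfolding P_def by blast
qed

text \<open>All quotients \<open>p\<^sub>i / q\<^sub>i\<close> are one and the same, so the first of them inherits the quality of every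
other one.\<close>

lemma eq_quotient_if_approximants:
  assumes f: "fls_subdegree f = -1" and q: "\<And>i. q i \<noteq> 0"
    and pq: "\<And>i. p i * q (Suc i) = p (Suc i) * q i"
    and o: "\<And>N::nat. \<exists>i. ord_ge (int N) (eval_fls (q i) f * h - eval_fls (p i) f)"
  shows "eval_fls (q 0) f * h = eval_fls (p 0) f"
proof -
  have eq: "p 0 * q i = p i * q 0" for i
  proof (induction i)
    case (Suc i)
    have "(p 0 * q (Suc i)) * q i = (p (Suc i) * q 0) * q i"
      using Suc pq[of i] by (metis mult.assoc mult.commute)
    then show ?case using q by simp
  qed simp
  have "eval_fls (q 0) f * h - eval_fls (p 0) f = 0"
  proof (rule eq_0_if_ord_ge)
    fix n
    obtain i where i: "ord_ge (int (n + degree (q 0))) (eval_fls (q i) f * h - eval_fls (p i) f)"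
      using o by blast
    have "(eval_fls (q 0) f * h - eval_fls (p 0) f) * eval_fls (q i) f = eval_fls (q 0) f * (eval_fls (q i) f * h) - eval_fls (p 0 * q i) f"
      by (simp add: algebra_simps)
    also have "\<dots> = eval_fls (q 0) f * (eval_fls (q i) f * h - eval_fls (p i) f)"
      by (simp add: eq algebra_simps)
    finally have e: "(eval_fls (q 0) f * h - eval_fls (p 0) f) * eval_fls (q i) f =
      eval_fls (q 0) f * (eval_fls (q i) f * h - eval_fls (p i) f)" .
    have "ord_ge (int n) (eval_fls (q 0) f * (eval_fls (q i) f * h - eval_fls (p i) f))"
      by (rule ord_ge_mult[OF ord_ge_subdegree i]) (simp add: subdegree_eval_fls_simple_pole[OF f])
    then have "ord_ge (int n) ((eval_fls (q 0) f * h - eval_fls (p 0) f) * eval_fls (q i) f)" by (simp add: e)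
    then have "ord_ge (int n - 0) (eval_fls (q 0) f * h - eval_fls (p 0) f)"
      by (rule ord_ge_cancel) (use subdegree_eval_fls[of f "q i"] f q in auto)
    then show "ord_ge (int n) (eval_fls (q 0) f * h - eval_fls (p 0) f)" by simp
  qed
  then show ?thesis by simp
qed

text \<open>Here \<open>(w d/dw H)\<^sup>2 - K\<^sup>2 H\<^sup>2\<close> is the product of a sum of order \<open>w^K\<close> and a difference of order
\<open>w^(-2K)\<close>.\<close>

lemma power_like_approximant:
  assumes H: "normal_gap K f H 0"
  shows "ord_ge (int K) (eval_fls (pderiv H ^ 2) f * euler f ^ 2 - eval_fls (smult (of_nat K ^ 2) (H ^ 2)) f)"
proof -
  obtain r where r: "eval_fls H f = fls_X_inv ^ K + fls_const 0 * fls_X ^ K + r"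
    "euler (eval_fls H f) = fls_const (of_nat K) * (fls_X_inv ^ K - fls_const 0 * fls_X ^ K) + euler r"
    "ord_ge (2 * int K) r" using normal_gap_expand[OF H] .
  define k where "k = fls_const (of_nat K :: complex)"
  have k: "ord_ge 0 k" by (simp add: k_def ord_ge_const)
  have tr: "ord_ge (2 * int K) (euler r)" using r(3) by (rule ord_ge_euler)
  have "eval_fls (pderiv H ^ 2) f * euler f ^ 2 - eval_fls (smult (of_nat K ^ 2) (H ^ 2)) f
      = (euler (eval_fls H f))\<^sup>2 - (k * eval_fls H f)\<^sup>2"
    by (simp add: euler_eval_fls power_mult_distrib k_def fls_const_power)
  also have "\<dots> = (euler r - k * r) * (2 * (k * fls_X_inv ^ K) + (euler r + k * r))"
    unfolding r(2) unfolding r(1) k_def[symmetric] by (simp add: power2_eq_square algebra_simps)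
  also have "ord_ge (int K) \<dots>"
  proof (rule ord_ge_mult)
    have kr: "ord_ge (2 * int K) (k * r)" by (rule ord_ge_mult[OF k r(3)]) simp
    show "ord_ge (2 * int K) (euler r - k * r)" using tr kr by (rule ord_ge_diff)
    have "ord_ge (2 * int K) (euler r + k * r)" using tr kr by (rule ord_ge_add)
    then have "ord_ge (- int K) (euler r + k * r)" by (rule ord_ge_mono) simp
    moreover have "ord_ge (- int K) (2 * (k * fls_X_inv ^ K))"
      by (simp add: k_def ord_ge_def fls_const_numeral[symmetric] del: fls_const_numeral)
    ultimately show "ord_ge (- int K) (2 * (k * fls_X_inv ^ K) + (euler r + k * r))"
      by (simp add: ord_ge_add)
  qed simp
  finally show ?thesis .
qed

text \<open>There is one approximant for each pair of neighbours in the chain. The coefficients \<open>e\<close> of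
\<open>w^(-N)\<close> vanish from some point on or never. In the first case the degrees of the approximants are not
small, but the vanishing Wronskians identify them directly; in the second case, the cross difference of two
successive approximants is a polynomial whose value at \<open>f\<close> is \<open>O(1/w)\<close>.\<close>

lemma euler_square_rational:
  assumes tw: "descends_twice k l f g" and "k \<ge> 2" "l \<ge> 2" "coprime k l"
  shows "\<exists>p q. q \<noteq> 0 \<and> eval_fls q f * euler f ^ 2 = eval_fls p f"
proof -
  have f: "fls_subdegree f = -1" using tw by (simp add: descends_twice_def)
  obtain s where s: "\<And>i. \<exists>a b. s i = k ^ a * l ^ b"
    and s_less: "\<And>i. s i < s (Suc i)" and s_close: "\<And>i. 8 * s (Suc i) \<le> 9 * s i"
    using ex_dense_chain[OF assms(2-4)] by blast
  have s0: "s i > 0" for i using s_less[of i] s_close[of i] by linarith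
  have s_ge: "i \<le> s i" for i
    by (rule seq_suble) (simp add: strict_mono_Suc_iff s_less)
  have "\<exists>H e. normal_gap (s i) f H e" for i
  proof -
    obtain a b where "s i = k ^ a * l ^ b" using s by blast
    then obtain G where "gap_poly (s i) f G"
      using ex_gap_poly_powers[OF tw, of a b] assms by auto
    with ex_normal_gap[OF f s0] show ?thesis by blast
  qed
  then obtain H e where H: "\<And>i. normal_gap (s i) f (H i) (e i)" by metis
  define J where "J i = s (Suc i) - s i" for i
  have J: "s (Suc i) = s i + J i" "8 * J i \<le> s i" "2 * J i < s i" for i
    using s_less[of i] s_close[of i] s0[of i] by (simp_all add: J_def)
  show ?thesis
  proof (cases "\<exists>i. e i = 0")
    case True
    then obtain i0 where "e i0 = 0" by blast
    have e0: "e (i0 + i) = 0" for i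
    proof (induction i)
      case (Suc i)
      show ?case
        using gap_wronskian_degenerate(1)[OF f _ H[of "Suc (i0 + i)"] s0 s_less J(1,3), of "H (i0 + i)"]
          H[of "i0 + i"] Suc by simp
    qed (use \<open>e i0 = 0\<close> in simp)
    have N: "normal_gap (s (i0 + i)) f (H (i0 + i)) 0" for i using H[of "i0 + i"] e0 by simp
    define p q where "p i = smult (of_nat (s (i0 + i)) ^ 2) (H (i0 + i) ^ 2)"
      and "q i = pderiv (H (i0 + i)) ^ 2" for i
    have deg: "degree (H i) = s i" for i using H by (simp add: normal_gap_def)
    have "eval_fls (q 0) f * euler f ^ 2 = eval_fls (p 0) f"
    proof (rule eq_quotient_if_approximants[OF f])
      show "q i \<noteq> 0" for i
        using s0[of "i0 + i"] by (simp add: q_def pderiv_eq_0_iff deg)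
      show "p i * q (Suc i) = p (Suc i) * q i" for i
      proof -
        have "gap_wronskian (H (i0 + i)) (H (Suc (i0 + i))) = 0"
          by (rule gap_wronskian_degenerate(2)[OF f N H s0 s_less J(1,3)])
        then have "smult (of_nat (s (i0 + i))) (H (i0 + i) * pderiv (H (Suc (i0 + i)))) =
            smult (of_nat (s (Suc (i0 + i)))) (H (Suc (i0 + i)) * pderiv (H (i0 + i)))"
          by (simp add: gap_wronskian_def deg)
        from arg_cong[OF this, of "\<lambda>x. x ^ 2"] show ?thesis
          by (simp add: p_def q_def smult_power[symmetric] power_mult_distrib flip: mult_smult_left)
      qed
      show "\<exists>i. ord_ge (int n) (eval_fls (q i) f * euler f ^ 2 - eval_fls (p i) f)" for n
      proof -
        have "ord_ge (int (s (i0 + n))) (eval_fls (q n) f * euler f ^ 2 - eval_fls (p n) f)"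
          unfolding p_def q_def by (rule power_like_approximant[OF N])
        then have "ord_ge (int n) (eval_fls (q n) f * euler f ^ 2 - eval_fls (p n) f)"
          by (rule ord_ge_mono) (use s_ge[of "i0 + n"] in simp)
        then show ?thesis ..
      qed
    qed
    moreover have "q 0 \<noteq> 0" using s0[of i0] by (simp add: q_def pderiv_eq_0_iff deg)
    ultimately show ?thesis by blast
  next
    case False
    then have e: "e i \<noteq> 0" for i by blast
    have "\<forall>i. \<exists>p q. q \<noteq> 0 \<and> degree q \<le> 2 * J i \<and>
        ord_ge (int (s i) - 2 * int (J i)) (eval_fls q f * euler f ^ 2 - eval_fls p f)"
      using chebyshev_like_approximant[OF f H H s0 s_less J(1,3) e] by blast
    then obtain p q where q: "\<And>i. q i \<noteq> 0" and dq: "\<And>i. degree (q i) \<le> 2 * J i"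
      and o: "\<And>i. ord_ge (int (s i) - 2 * int (J i)) (eval_fls (q i) f * euler f ^ 2 - eval_fls (p i) f)"
      by metis
    have "eval_fls (q 0) f * euler f ^ 2 = eval_fls (p 0) f"
    proof (rule eq_quotient_if_approximants[OF f])
      show "q i \<noteq> 0" for i by (rule q)
      show "p i * q (Suc i) = p (Suc i) * q i" for i
      proof -
        have oq: "ord_ge (- 2 * int (J i)) (eval_fls (q i) f)" for i
          by (rule ord_ge_mono[OF ord_ge_subdegree]) (use dq[of i] in \<open>simp add: subdegree_eval_fls_simple_pole[OF f]\<close>)
        let ?d = "\<lambda>i. eval_fls (q i) f * euler f ^ 2 - eval_fls (p i) f"
        have "ord_ge 1 (?d i * eval_fls (q (Suc i)) f)"
          by (rule ord_ge_mult[OF o oq]) (use J[of i] J[of "Suc i"] s0[of i] in linarith)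
        moreover have "ord_ge 1 (?d (Suc i) * eval_fls (q i) f)"
          by (rule ord_ge_mult[OF o oq]) (use J[of i] J[of "Suc i"] s0[of i] in linarith)
        ultimately have "ord_ge 1 (?d (Suc i) * eval_fls (q i) f - ?d i * eval_fls (q (Suc i)) f)"
          by (intro ord_ge_diff)
        also have "?d (Suc i) * eval_fls (q i) f - ?d i * eval_fls (q (Suc i)) f = eval_fls (p i * q (Suc i) - p (Suc i) * q i) f"
          by (simp add: algebra_simps)
        finally show ?thesis using eval_fls_eq_0_if_ord_ge_1[OF f] by (metis right_minus_eq)
      qed
      show "\<exists>i. ord_ge (int n) (eval_fls (q i) f * euler f ^ 2 - eval_fls (p i) f)" for n
        by (rule exI[of _ "2 * n"], rule ord_ge_mono[OF o])
          (use s_ge[of "2 * n"] J(2)[of "2 * n"] in linarith)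
    qed
    with q show ?thesis by blast
  qed
qed

section \<open>The differential equation of special polynomials\<close>

text \<open>Let \<open>p/q\<close> be in lowest terms. Applying \<open>w \<mapsto> w^n\<close> to the relation at \<open>f\<close> gives
\<open>A'\<^sup>2 (p/q) = n\<^sup>2 (p/q) \<circ> A\<close>. Since \<open>p \<circ> A\<close> and \<open>q \<circ> A\<close> are again coprime, \<open>q \<circ> A\<close> divides \<open>q\<close>, which
is impossible for degree reasons unless \<open>q\<close> is constant. The degree of \<open>p\<close> is the order of the pole of
\<open>(w f')\<^sup>2\<close>.\<close>

lemma quadratic_functional_equation:
  assumes f: "fls_subdegree f = -1" and A: "degree A = n" "n \<ge> 2" "eval_fls A f = subst_monom 1 n f"
    and pq: "q \<noteq> 0" "eval_fls q f * euler f ^ 2 = eval_fls p f"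
  shows "\<exists>p. degree p = 2 \<and> pderiv A ^ 2 * p = smult (of_nat n ^ 2) (p \<circ>\<^sub>p A)"
proof -
  have n: "n > 0" using A by simp
  have t: "fls_subdegree (euler f) = -1" by (rule subdegree_euler[OF f])
  then have t0: "euler f \<noteq> 0" by auto
  have chain: "eval_fls (pderiv A) f * euler f = of_nat n * subst_monom 1 n (euler f)"
    by (metis A(3) n euler_eval_fls euler_subst_monom zero_neq_one)
  define d where "d = gcd p q"
  obtain p1 q1 where p1: "p = p1 * d" and q1: "q = q1 * d" and cop: "coprime p1 q1"
    unfolding d_def by (metis gcd_coprime_exists gcd_eq_0_iff pq(1))
  have d0: "d \<noteq> 0" and q10: "q1 \<noteq> 0" using pq(1) q1 by auto
  have dn: "eval_fls d f \<noteq> 0" using subdegree_eval_fls[of f d] f d0 by simp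
  have r: "eval_fls q1 f * euler f ^ 2 = eval_fls p1 f"
    using pq(2) dn by (simp add: p1 q1 mult.assoc mult.left_commute mult.commute)
  have "subst_monom 1 n (eval_fls q1 f * euler f ^ 2) = subst_monom 1 n (eval_fls p1 f)" using r by simp
  then have s: "eval_fls (q1 \<circ>\<^sub>p A) f * subst_monom 1 n (euler f) ^ 2 = eval_fls (p1 \<circ>\<^sub>p A) f"
    using n by (simp add: subst_monom_mult subst_monom_power subst_monom_eval_fls A(3))
  have "eval_fls (q1 \<circ>\<^sub>p A * (pderiv A ^ 2 * p1)) f =
      eval_fls (q1 \<circ>\<^sub>p A) f * (eval_fls (pderiv A) f * euler f) ^ 2 * eval_fls q1 f"
    by (simp add: r[symmetric] power_mult_distrib mult_ac)
  also have "\<dots> = of_nat n ^ 2 * (eval_fls (q1 \<circ>\<^sub>p A) f * subst_monom 1 n (euler f) ^ 2) * eval_fls q1 f"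
    unfolding chain by (simp add: power_mult_distrib mult_ac)
  also have "\<dots> = eval_fls (smult (of_nat n ^ 2) (p1 \<circ>\<^sub>p A) * q1) f"
    unfolding s by (simp add: fls_of_nat fls_const_power)
  finally have e: "q1 \<circ>\<^sub>p A * (pderiv A ^ 2 * p1) = smult (of_nat n ^ 2) (p1 \<circ>\<^sub>p A) * q1"
    by (rule iffD1[OF eval_fls_eq_iff, rotated]) (simp add: f)
  have copA: "coprime (q1 \<circ>\<^sub>p A) (p1 \<circ>\<^sub>p A)"
  proof -
    obtain u v where "u * p1 + v * q1 = 1" using cop by (metis bezout_coefficients_fst_snd coprime_iff_gcd_eq_1)
    then have b: "u \<circ>\<^sub>p A * p1 \<circ>\<^sub>p A + v \<circ>\<^sub>p A * q1 \<circ>\<^sub>p A = 1"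
      by (metis pcompose_1 pcompose_add pcompose_mult)
    show ?thesis
    proof (rule coprimeI)
      fix c assume "c dvd q1 \<circ>\<^sub>p A" "c dvd p1 \<circ>\<^sub>p A"
      then have "c dvd u \<circ>\<^sub>p A * p1 \<circ>\<^sub>p A + v \<circ>\<^sub>p A * q1 \<circ>\<^sub>p A" by simp
      then show "is_unit c" using b by simp
    qed
  qed
  have "q1 \<circ>\<^sub>p A dvd p1 \<circ>\<^sub>p A * smult (of_nat n ^ 2) q1"
    using e by (metis dvd_triv_left mult_smult_left mult_smult_right)
  then have "q1 \<circ>\<^sub>p A dvd smult (of_nat n ^ 2) q1"
    using copA coprime_dvd_mult_right_iff by blast
  then have "q1 \<circ>\<^sub>p A dvd q1" using n by (simp add: dvd_smult_iff)
  then have "degree (q1 \<circ>\<^sub>p A) \<le> degree q1" using q10 by (rule dvd_imp_degree_le)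
  then have "degree q1 * n \<le> degree q1 * 1" by (simp add: degree_pcompose A(1))
  then have "degree q1 = 0" using A(2) by simp
  then obtain c where c: "q1 = [:c:]" by (metis degree_eq_zeroE)
  have c0: "c \<noteq> 0" using q10 c by simp
  have "smult c (pderiv A ^ 2 * p1) = smult c (smult (of_nat n ^ 2) (p1 \<circ>\<^sub>p A))"
    using e by (simp add: c mult_ac)
  then have fe: "pderiv A ^ 2 * p1 = smult (of_nat n ^ 2) (p1 \<circ>\<^sub>p A)"
    using c0 smult_cancel by blast
  have "int (degree p1) = 2"
  proof -
    have "- int (degree p1) = fls_subdegree (fls_const c * euler f ^ 2)"
      using r f by (simp add: c subdegree_eval_fls_simple_pole[symmetric])
    also have "\<dots> = -2" using c0 t0 t by (simp add: fls_subdegree_pow)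
    finally show ?thesis by simp
  qed
  then show ?thesis using fe by (intro exI[of _ p1]) simp
qed

text \<open>The defining relation of conjugacy, with the inverse \<open>[:b, m:]\<close> of the conjugating map on
the other side, so that no explicit inverse has to be given.\<close>

lemma conjugate_polyI:
  assumes "m \<noteq> 0" and Q: "P \<circ>\<^sub>p [:b, m:] = [:b, m:] \<circ>\<^sub>p Q"
  shows "conjugate_poly P Q"
proof -
  define M L where "M = [:b, m:]" and "L = [:- b / m, 1 / m:]"
  have M_L: "M \<circ>\<^sub>p L = [:0, 1:]" and L_M: "L \<circ>\<^sub>p M = [:0, 1:]"
    using assms(1) by (simp_all add: M_def L_def pcompose_pCons)
  have "L \<circ>\<^sub>p P \<circ>\<^sub>p M = L \<circ>\<^sub>p (M \<circ>\<^sub>p Q)"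
    using Q by (simp add: M_def pcompose_assoc[symmetric])
  also have "\<dots> = Q" by (simp add: pcompose_assoc L_M) (simp add: pcompose_pCons)
  finally show ?thesis
    unfolding conjugate_poly_def using M_L L_M assms(1)
    by (intro exI[of _ L] exI[of _ M]) (simp add: L_def)
qed

lemma ex_conjugation:
  assumes "m \<noteq> (0 :: complex)"
  shows "\<exists>Q. P \<circ>\<^sub>p [:b, m:] = [:b, m:] \<circ>\<^sub>p Q \<and> degree Q = degree P"
proof -
  define M L where "M = [:b, m:]" and "L = [:- b / m, 1 / m:]"
  have M_L: "M \<circ>\<^sub>p L = [:0, 1:]"
    using assms(1) by (simp_all add: M_def L_def pcompose_pCons)
  have "M \<circ>\<^sub>p (L \<circ>\<^sub>p P \<circ>\<^sub>p M) = P \<circ>\<^sub>p M"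
    by (simp add: pcompose_assoc M_L) (simp add: pcompose_pCons)
  moreover have "degree (L \<circ>\<^sub>p P \<circ>\<^sub>p M) = degree P"
    using assms by (simp add: degree_pcompose L_def M_def)
  ultimately show ?thesis by (metis M_def)
qed

lemma conjugated_functional_equation:
  assumes m: "m \<noteq> (0 :: complex)" and Q: "A \<circ>\<^sub>p [:b, m:] = [:b, m:] \<circ>\<^sub>p Q"
    and fe: "pderiv A ^ 2 * p = smult c (p \<circ>\<^sub>p A)"
  shows "pderiv Q ^ 2 * (p \<circ>\<^sub>p [:b, m:]) = smult c (p \<circ>\<^sub>p [:b, m:] \<circ>\<^sub>p Q)"
proof -
  define M where "M = [:b, m:]"
  have dM: "pderiv M = [:m:]" by (simp add: M_def pderiv_pCons)
  have "pderiv (A \<circ>\<^sub>p M) = pderiv (M \<circ>\<^sub>p Q)" using Q by (simp add: M_def)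
  then have "smult m (pderiv A \<circ>\<^sub>p M) = smult m (pderiv Q)"
    by (simp add: pderiv_pcompose dM)
  then have d: "pderiv A \<circ>\<^sub>p M = pderiv Q" using m smult_cancel by blast
  have "(pderiv A ^ 2 * p) \<circ>\<^sub>p M = smult c (p \<circ>\<^sub>p A) \<circ>\<^sub>p M" using fe by simp
  then have "pderiv Q ^ 2 * (p \<circ>\<^sub>p M) = smult c (p \<circ>\<^sub>p (A \<circ>\<^sub>p M))"
    by (simp add: power2_eq_square pcompose_mult pcompose_smult pcompose_assoc d)
  also have "\<dots> = smult c (p \<circ>\<^sub>p M \<circ>\<^sub>p Q)"
    using Q by (simp add: M_def pcompose_assoc)
  finally show ?thesis by (simp add: M_def)
qed

lemma ex_nonzero_root:
  assumes "n > 0" "c \<noteq> (0 :: complex)"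
  shows "\<exists>z. z \<noteq> 0 \<and> z ^ n = c"
proof -
  obtain z where z: "z ^ n = c"
  proof -
    have "\<not> constant (poly (monom 1 n - [:c:]))"
    proof -
      have "degree (monom 1 n - [:c:]) = n"
        using degree_add_eq_left[of "- [:c:]" "monom 1 n"] assms
        by (simp only: diff_conv_add_uminus) (simp add: degree_monom_eq)
      then show ?thesis using assms by (simp add: constant_degree)
    qed
    from fundamental_theorem_of_algebra[OF this] that show ?thesis
      by (auto simp: poly_monom)
  qed
  then show ?thesis using assms by (metis power_0_left less_numeral_extra(3))
qed

text \<open>The equation is the square of \<open>z Q' = \<plusminus>n Q\<close>. The leading coefficient fixes the sign, and the
remaining coefficients vanish.\<close>

lemma power_case:
  fixes Q :: "complex poly"
  assumes n: "degree Q = n" "n \<ge> 2" and fe: "pderiv Q ^ 2 * monom 1 2 = smult (of_nat n ^ 2) (Q ^ 2)"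
  shows "\<exists>c. c \<noteq> 0 \<and> Q = monom c n"
proof -
  define R where "R = pCons 0 (pderiv Q)"
  have "R ^ 2 = (smult (of_nat n) Q) ^ 2"
    using fe by (simp add: R_def monom_altdef power2_eq_square smult_power[symmetric])
  then have "R = smult (of_nat n) Q \<or> R = - smult (of_nat n) Q"
    by (simp add: power2_eq_iff)
  moreover have co: "coeff R j = of_nat j * coeff Q j" for j
    by (cases j) (simp_all add: R_def coeff_pderiv)
  have Q0: "coeff Q n \<noteq> 0" using n by auto
  have "R \<noteq> - smult (of_nat n) Q"
  proof
    assume "R = - smult (of_nat n) Q"
    then have "of_nat n * coeff Q n = - (of_nat n * coeff Q n)" using co[of n] by simp
    then show False using Q0 n by simp
  qed
  ultimately have "R = smult (of_nat n) Q" by blast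
  then have "of_nat j * coeff Q j = of_nat n * coeff Q j" for j using co[of j] by auto
  then have "coeff Q j = 0" if "j \<noteq> n" for j using that by (metis mult_cancel_right of_nat_eq_iff)
  then have "Q = monom (coeff Q n) n" by (intro poly_eqI) auto
  then show ?thesis using Q0 by blast
qed

lemma conjugate_power:
  assumes n: "n \<ge> 2" and P: "P \<circ>\<^sub>p [:b, m:] = [:b, m:] \<circ>\<^sub>p monom c n" and "m \<noteq> 0" "c \<noteq> 0"
  shows "conjugate_poly P (monom 1 n)"
proof -
  obtain z where z: "z \<noteq> 0" "z ^ (n - 1) = 1 / c"
    using ex_nonzero_root[of "n - 1" "1 / c"] assms by auto
  have zn: "c * z ^ n = z"
  proof -
    have "z ^ n = z * z ^ (n - 1)" using n by (cases n) auto
    then show ?thesis using z assms by simp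
  qed
  have M: "[:b, m * z:] = [:b, m:] \<circ>\<^sub>p [:0, z:]" by (simp add: pcompose_pCons)
  have "poly (monom c n \<circ>\<^sub>p [:0, z:]) x = poly ([:0, z:] \<circ>\<^sub>p monom 1 n) x" for x
    using zn by (simp add: poly_pcompose poly_monom power_mult_distrib)
  then have "monom c n \<circ>\<^sub>p [:0, z:] = [:0, z:] \<circ>\<^sub>p monom 1 n" by (simp add: poly_eq_poly_eq_iff[symmetric] fun_eq_iff)
  then have "P \<circ>\<^sub>p [:b, m * z:] = [:b, m * z:] \<circ>\<^sub>p monom 1 n"
    using P unfolding M by (metis pcompose_assoc)
  then show ?thesis using z assms by (intro conjugate_polyI) auto
qed

text \<open>Differentiate \<open>T\<^sub>n(cos t) = cos (n t)\<close> and square. The identity then holds on \<open>[-1, 1]\<close>, hence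
everywhere.\<close>

lemma chebyshev_first_order:
  "[:-1, 0, 1:] * pderiv (chebyshev_poly n) ^ 2 = smult (of_nat n ^ 2) (chebyshev_poly n ^ 2 - 1)"
proof -
  define T where "T = chebyshev_poly n"
  define U where "U = [:-1, 0, 1:] * pderiv T ^ 2 - smult (of_nat n ^ 2) (T ^ 2 - 1)"
  have zero: "poly U (of_real (cos t)) = 0" for t :: real
  proof -
    have d1: "((\<lambda>t. poly T (of_real (cos t))) has_vector_derivative
        (- of_real (sin t) * poly (pderiv T) (of_real (cos t)))) (at t)"
    proof -
      have "((\<lambda>t. of_real (cos t) :: complex) has_vector_derivative of_real (- sin t)) (at t)"
        by (rule has_vector_derivative_of_real) (auto intro!: derivative_eq_intros simp: has_real_derivative_iff_has_vector_derivative[symmetric])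
      from field_vector_diff_chain_at[OF this poly_DERIV[of T]] show ?thesis
        by (simp add: o_def)
    qed
    have d2: "((\<lambda>t. of_real (cos (real n * t)) :: complex) has_vector_derivative
        of_real (- real n * sin (real n * t))) (at t)"
      by (rule has_vector_derivative_of_real) (auto intro!: derivative_eq_intros simp: has_real_derivative_iff_has_vector_derivative[symmetric])
    have "(\<lambda>t. poly T (of_real (cos t))) = (\<lambda>t. of_real (cos (real n * t)))"
      by (simp add: T_def poly_chebyshev_poly_cos)
    then have "- of_real (sin t) * poly (pderiv T) (of_real (cos t)) = of_real (- real n * sin (real n * t))"
      using vector_derivative_unique_at[OF d1] d2 by metis
    then have "(of_real (sin t) * poly (pderiv T) (of_real (cos t))) ^ 2 = (of_real (real n * sin (real n * t)) :: complex) ^ 2"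
      by (metis minus_mult_left of_real_minus power2_minus)
    then have "of_real (sin t ^ 2) * poly (pderiv T) (of_real (cos t)) ^ 2 =
        of_nat n ^ 2 * of_real (sin (real n * t) ^ 2)"
      by (simp add: power_mult_distrib)
    then have "of_real (1 - cos t ^ 2) * poly (pderiv T) (of_real (cos t)) ^ 2 =
        of_nat n ^ 2 * of_real (1 - cos (real n * t) ^ 2)"
      by (simp only: sin_squared_eq)
    moreover have "poly T (of_real (cos t)) = of_real (cos (real n * t))"
      by (simp add: T_def poly_chebyshev_poly_cos)
    ultimately show ?thesis
      by (simp add: U_def power2_eq_square algebra_simps)
  qed
  have "U = 0"
  proof (rule ccontr)
    assume "U \<noteq> 0"
    then have "finite {z. poly U z = 0}" by (rule poly_roots_finite)
    moreover have "(of_real :: real \<Rightarrow> complex) ` {-1..1} \<subseteq> {z. poly U z = 0}"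
    proof safe
      fix x :: real assume "x \<in> {-1..1}"
      then have "x = cos (arccos x)" by simp
      then show "poly U (of_real x) = 0" using zero by metis
    qed
    ultimately have "finite ((of_real :: real \<Rightarrow> complex) ` {-1..1})" by (rule finite_subset[rotated])
    then have "finite {-1..(1::real)}" by (rule finite_imageD) (simp add: inj_on_def)
    then show False by (simp add: infinite_Icc)
  qed
  then show ?thesis by (simp add: U_def T_def)
qed

text \<open>The derivative of the first order equation, divided by \<open>2 P'\<close>. Unlike that equation, it is
linear in \<open>P\<close>.\<close>

lemma chebyshev_second_order:
  fixes P :: "complex poly"
  assumes P: "degree P > 0" and fe: "[:-1, 0, 1:] * pderiv P ^ 2 = smult (c ^ 2) (P ^ 2 - 1)"
  shows "[:-1, 0, 1:] * pderiv (pderiv P) + pCons 0 (pderiv P) = smult (c ^ 2) P"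
proof -
  define V X :: "complex poly" where "V = [:-1, 0, 1:]" and "X = [:0, 1:]"
  have dV: "pderiv V = 2 * X" by (simp add: V_def X_def pderiv_pCons numeral_poly)
  have "pderiv (V * pderiv P ^ 2) = pderiv (smult (c ^ 2) (P ^ 2 - 1))"
    using fe by (simp add: V_def)
  then have "(2 * pderiv P) * (V * pderiv (pderiv P) + X * pderiv P) = (2 * pderiv P) * smult (c ^ 2) P"
    by (simp add: pderiv_mult pderiv_smult pderiv_diff power2_eq_square dV algebra_simps)
  moreover have "2 * pderiv P \<noteq> 0" using P by (simp add: pderiv_eq_0_iff)
  ultimately have "V * pderiv (pderiv P) + X * pderiv P = smult (c ^ 2) P"
    using mult_left_cancel by blast
  then show ?thesis by (simp add: V_def X_def)
qed

lemma chebyshev_second_order_coeff: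
  fixes P :: "complex poly"
  assumes "[:-1, 0, 1:] * pderiv (pderiv P) + pCons 0 (pderiv P) = smult (c ^ 2) P"
  shows "(of_nat j ^ 2 - c ^ 2) * coeff P j = of_nat ((j + 2) * (j + 1)) * coeff P (j + 2)"
proof -
  have "coeff ([:-1, 0, 1:] * pderiv (pderiv P) + pCons 0 (pderiv P)) j = c ^ 2 * coeff P j"
    using assms by simp
  moreover have "[:-1, 0, 1:] * pderiv (pderiv P) = pCons 0 (pCons 0 (pderiv (pderiv P))) - pderiv (pderiv P)"
    by simp
  ultimately have *: "coeff (pCons 0 (pCons 0 (pderiv (pderiv P)))) j - coeff (pderiv (pderiv P)) j +
      coeff (pCons 0 (pderiv P)) j = c ^ 2 * coeff P j"
    by simp
  have "coeff (pCons 0 (pderiv P)) j = of_nat j * coeff P j"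
    by (cases j) (simp_all add: coeff_pderiv)
  moreover have "coeff (pCons 0 (pCons 0 (pderiv (pderiv P)))) j = of_nat j * (of_nat j - 1) * coeff P j"
  proof (cases j)
    case (Suc i)
    then show ?thesis by (cases i) (simp_all add: coeff_pderiv algebra_simps)
  qed simp
  moreover have "coeff (pderiv (pderiv P)) j = of_nat ((j + 2) * (j + 1)) * coeff P (j + 2)"
    by (simp add: coeff_pderiv algebra_simps)
  ultimately show ?thesis using * by (simp add: power2_eq_square algebra_simps)
qed

lemma degree_chebyshev_ode_solution:
  fixes P :: "complex poly"
  assumes ode: "[:-1, 0, 1:] * pderiv (pderiv P) + pCons 0 (pderiv P) = smult (of_nat n ^ 2) P" and "P \<noteq> 0"
  shows "degree P = n"
proof -
  have "coeff P (degree P + 2) = 0" by (simp add: coeff_eq_0)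
  then have "(of_nat (degree P) ^ 2 - of_nat n ^ 2 :: complex) * lead_coeff P = 0"
    using chebyshev_second_order_coeff[OF ode, of "degree P"] by simp
  then have "(of_nat (degree P) ^ 2 :: complex) = of_nat n ^ 2" using assms(2) by simp
  then have "(of_nat (degree P ^ 2) :: complex) = of_nat (n ^ 2)" by simp
  then show ?thesis unfolding of_nat_eq_iff by simp
qed

text \<open>By linearity, \<open>Q - c T\<^sub>n\<close> solves the second order equation for every \<open>c\<close>. If \<open>c\<close> cancels the
leading term, the degree is no longer \<open>n\<close>, so the difference is zero; the first order equation then
forces \<open>c\<^sup>2 = 1\<close>.\<close>

lemma chebyshev_case:
  assumes n: "degree Q = n" "n \<ge> 2" and fe: "[:-1, 0, 1:] * pderiv Q ^ 2 = smult (of_nat n ^ 2) (Q ^ 2 - 1)"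
  shows "Q = chebyshev_poly n \<or> Q = - chebyshev_poly n"
proof -
  define T where "T = chebyshev_poly n"
  note T1 = chebyshev_first_order[of n, folded T_def]
  have "degree T \<noteq> 0"
  proof
    assume "degree T = 0"
    then obtain c where "T = [:c:]" by (metis degree_eq_zeroE)
    then have "cos (real n * t) = cos (real n * s)" for s t
      using poly_chebyshev_poly_cos[of n t] poly_chebyshev_poly_cos[of n s] by (simp add: T_def)
    from this[of 0 "pi / real n"] show False using n by simp
  qed
  then have Tp: "degree T > 0" by simp
  note T2 = chebyshev_second_order[OF Tp T1]
  have Q2: "[:-1, 0, 1:] * pderiv (pderiv Q) + pCons 0 (pderiv Q) = smult (of_nat n ^ 2) Q"
    by (rule chebyshev_second_order[OF _ fe]) (use n in simp)
  have dT: "degree T = n" by (rule degree_chebyshev_ode_solution[OF T2]) (use Tp in auto)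
  define c where "c = lead_coeff Q / lead_coeff T"
  define R where "R = Q - smult c T"
  have "T \<noteq> 0" using Tp by auto
  have R2: "[:-1, 0, 1:] * pderiv (pderiv R) + pCons 0 (pderiv R) = smult (of_nat n ^ 2) R"
  proof -
    have "[:-1, 0, 1:] * pderiv (pderiv R) + [:0, 1:] * pderiv R =
      ([:-1, 0, 1:] * pderiv (pderiv Q) + [:0, 1:] * pderiv Q) - smult c ([:-1, 0, 1:] * pderiv (pderiv T) + [:0, 1:] * pderiv T)"
      by (simp only: R_def pderiv_diff pderiv_smult ring_distribs smult_add_right smult_diff_right mult_smult_right) (simp add: algebra_simps)
    then show ?thesis using Q2 T2 by (simp add: R_def smult_diff_right mult.commute)
  qed
  have "R = 0"
  proof (rule ccontr)
    assume "R \<noteq> 0"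
    then have "degree R = n" by (rule degree_chebyshev_ode_solution[OF R2])
    moreover have "coeff T n \<noteq> 0" using \<open>T \<noteq> 0\<close> dT by auto
    then have "coeff R n = 0" using dT n by (simp add: R_def c_def)
    ultimately show False using \<open>R \<noteq> 0\<close> by (metis leading_coeff_0_iff)
  qed
  then have Q: "Q = smult c T" by (simp add: R_def)
  have "smult (of_nat n ^ 2) (Q ^ 2 - 1) = [:-1, 0, 1:] * pderiv Q ^ 2"
    by (rule fe[symmetric])
  also have "\<dots> = smult (c ^ 2) ([:-1, 0, 1:] * pderiv T ^ 2)"
    by (simp only: Q pderiv_smult power2_eq_square mult_smult_left mult_smult_right smult_smult)
  also have "\<dots> = smult (of_nat n ^ 2) (Q ^ 2 - smult (c ^ 2) 1)"
    unfolding T1 Q by (simp add: smult_diff_right power2_eq_square mult_ac)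
  finally have "Q ^ 2 - 1 = Q ^ 2 - smult (c ^ 2) 1"
    using n smult_cancel[of "of_nat n ^ 2 :: complex"] by auto
  then have "poly (Q ^ 2 - 1) 0 = poly (Q ^ 2 - smult (c ^ 2) 1) 0" by (rule arg_cong)
  then have "c ^ 2 = 1" by simp
  then have "c = 1 \<or> c = -1" by (simp add: power2_eq_1_iff)
  then show ?thesis using Q by (auto simp: T_def)
qed

text \<open>An affine change of coordinates moves the roots of \<open>p\<close> to \<open>\<plusminus>1\<close>, or to \<open>0\<close> if they coincide.\<close>

lemma special_if_functional_equation:
  assumes n: "degree A = n" "n \<ge> 2" and p: "degree p = 2"
    and fe: "pderiv A ^ 2 * p = smult (of_nat n ^ 2) (p \<circ>\<^sub>p A)"
  shows "special_poly A"
proof -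
  have "\<not> constant (poly p)" using p by (simp add: constant_degree)
  then obtain r where r: "poly p r = 0" using fundamental_theorem_of_algebra by blast
  then obtain p' where p': "p = [:- r, 1:] * p'" by (metis dvdE poly_eq_0_iff_dvd)
  have "p' \<noteq> 0" using p p' by auto
  then have dp': "degree p' = 1" using p unfolding p' by (subst (asm) degree_mult_eq) auto
  then have "\<not> constant (poly p')" by (simp add: constant_degree)
  then obtain s where s: "poly p' s = 0" using fundamental_theorem_of_algebra by blast
  then obtain p'' where p'': "p' = [:- s, 1:] * p''" by (metis dvdE poly_eq_0_iff_dvd)
  have "p'' \<noteq> 0" using dp' p'' by auto
  then have "degree p'' = 0" using dp' unfolding p'' by (subst (asm) degree_mult_eq) auto
  then obtain a where "p'' = [:a:]" by (metis degree_eq_zeroE)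
  then have pe: "p = smult a ([:- r, 1:] * [:- s, 1:])" and a: "a \<noteq> 0"
    using p' p'' \<open>p'' \<noteq> 0\<close> by (simp_all add: algebra_simps)
  show ?thesis
  proof (cases "r = s")
    case True
    obtain Q where Q: "A \<circ>\<^sub>p [:r, 1:] = [:r, 1:] \<circ>\<^sub>p Q" "degree Q = degree A"
      using ex_conjugation[of 1 A r] by auto
    have c: "p \<circ>\<^sub>p [:r, 1:] = smult a (monom 1 2)"
      unfolding pe True by (simp add: pcompose_smult pcompose_mult pcompose_pCons monom_altdef power2_eq_square)
    have "pderiv Q ^ 2 * (p \<circ>\<^sub>p [:r, 1:]) = smult (of_nat n ^ 2) (p \<circ>\<^sub>p [:r, 1:] \<circ>\<^sub>p Q)"
      by (rule conjugated_functional_equation[OF _ Q(1) fe]) simp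
    then have "smult a (pderiv Q ^ 2 * monom 1 2) = smult a (smult (of_nat n ^ 2) (Q ^ 2))"
      unfolding c by (simp add: pcompose_smult monom_altdef pcompose_mult power2_eq_square pcompose_pCons mult_ac)
    then have "pderiv Q ^ 2 * monom 1 2 = smult (of_nat n ^ 2) (Q ^ 2)"
      using a smult_cancel by blast
    then obtain c where c: "c \<noteq> 0" "Q = monom c n"
      using power_case[of Q n] Q n by auto
    have "conjugate_poly A (monom 1 n)"
      using conjugate_power[of n A r 1 c] Q c n by auto
    then show ?thesis using n by (simp add: special_poly_def)
  next
    case False
    define m b where "m = (r - s) / 2" and "b = (r + s) / 2"
    have m: "m \<noteq> 0" using False by (simp add: m_def)
    obtain Q where Q: "A \<circ>\<^sub>p [:b, m:] = [:b, m:] \<circ>\<^sub>p Q" "degree Q = degree A"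
      using ex_conjugation[OF m] by auto
    have rs: "r = b + m" "s = b - m" by (simp_all add: b_def m_def field_simps)
    have c: "p \<circ>\<^sub>p [:b, m:] = smult (a * m ^ 2) [:-1, 0, 1:]"
      unfolding pe rs by (simp add: pcompose_smult pcompose_mult pcompose_pCons power2_eq_square algebra_simps)
    have z: "[:-1, 0, 1:] \<circ>\<^sub>p Q = Q ^ 2 - 1"
      by (simp add: pcompose_pCons power2_eq_square one_pCons)
    have "pderiv Q ^ 2 * (p \<circ>\<^sub>p [:b, m:]) = smult (of_nat n ^ 2) (p \<circ>\<^sub>p [:b, m:] \<circ>\<^sub>p Q)"
      by (rule conjugated_functional_equation[OF m Q(1) fe])
    then have "smult (a * m ^ 2) ([:-1, 0, 1:] * pderiv Q ^ 2) = smult (a * m ^ 2) (smult (of_nat n ^ 2) (Q ^ 2 - 1))"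
      unfolding c pcompose_smult z by (simp only: mult_smult_right mult_smult_left smult_smult mult_ac)
    then have "[:-1, 0, 1:] * pderiv Q ^ 2 = smult (of_nat n ^ 2) (Q ^ 2 - 1)"
      using a m smult_cancel[of "a * m ^ 2"] by auto
    then have "Q = chebyshev_poly n \<or> Q = - chebyshev_poly n"
      using chebyshev_case[of Q n] Q n by simp
    then have "conjugate_poly A (chebyshev_poly n) \<or> conjugate_poly A (- chebyshev_poly n)"
      using conjugate_polyI[OF m] Q(1) by blast
    then show ?thesis using n by (auto simp: special_poly_def)
  qed
qed

section \<open>Semiconjugacies through Boettcher series\<close>

lemma special_if_coprime_descents:
  assumes "descends_twice k l f g" "k \<ge> 2" "l \<ge> 2" "coprime k l"
    and "degree A = n" "n \<ge> 2" "eval_fls A f = subst_monom 1 n f"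
  shows "special_poly A"
proof -
  have f: "fls_subdegree f = -1" using assms(1) by (simp add: descends_twice_def)
  obtain p q where "q \<noteq> 0" "eval_fls q f * euler f ^ 2 = eval_fls p f"
    using euler_square_rational[OF assms(1-4)] by blast
  with quadratic_functional_equation[OF f assms(5-7)] special_if_functional_equation[OF assms(5,6)]
  show ?thesis by blast
qed

text \<open>Compare the coefficients of \<open>w^(kn)\<close> in \<open>A(f(w)) = f(w^n)\<close>.\<close>

lemma bottcher_leading_coeff:
  assumes A: "degree A = n" "n \<ge> 2" and f: "fls_subdegree f = - int k" "k > 0" "eval_fls A f = subst_monom 1 n f"
  shows "lead_coeff A * fls_nth f (- int k) ^ n = fls_nth f (- int k)"
proof -
  have o: "ord_ge (- int k) f" using ord_ge_subdegree[of f] f by simp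
  have "fls_nth (eval_fls A f) (- int k * int n) = lead_coeff A * fls_nth f (- int k) ^ n"
    using eval_fls_at_bound[OF o f(2), of A] A(1) by simp
  moreover have "fls_nth (subst_monom 1 n f) (int n * (- int k)) = fls_nth f (- int k)"
    using subst_monom_nth_mult[of 1 n f "- int k"] A(2) by simp
  ultimately show ?thesis using f(3) by (simp add: mult.commute)
qed

text \<open>The leading coefficients \<open>u\<close> of \<open>f\<close> and \<open>v\<close> of \<open>g\<close> have the same \<open>(n-1)\<close>-st power, so \<open>c = u/v\<close>
satisfies \<open>c^n = c\<close>. Hence \<open>g\<close> and the substituted \<open>f\<close> solve the same equation with the same leading
coefficient.\<close>

lemma bottcher_power_substitution:
  assumes A: "degree A = n" "n \<ge> 2" and f: "fls_subdegree f = -1" "eval_fls A f = subst_monom 1 n f"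
    and g: "fls_subdegree g = - int k" "k > 0" "eval_fls A g = subst_monom 1 n g"
  shows "\<exists>c. c \<noteq> 0 \<and> g = subst_monom c k f"
proof -
  define u v where "u = fls_nth f (-1)" and "v = fls_nth g (- int k)"
  have u0: "u \<noteq> 0" using f nth_fls_subdegree_nonzero[of f] by (force simp: u_def)
  have v0: "v \<noteq> 0" using g nth_fls_subdegree_nonzero[of g] by (force simp: v_def)
  have u: "lead_coeff A * u ^ n = u" using bottcher_leading_coeff[OF A, of f 1] f by (simp add: u_def)
  have v: "lead_coeff A * v ^ n = v" using bottcher_leading_coeff[OF A g] by (simp add: v_def)
  define c where "c = u / v"
  have c0: "c \<noteq> 0" using u0 v0 by (simp add: c_def)
  have "lead_coeff A * u ^ n * v = lead_coeff A * v ^ n * u" using u v by simp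
  moreover have "lead_coeff A \<noteq> 0" using A by auto
  ultimately have "u ^ n * v = v ^ n * u" by simp
  then have cn: "c ^ n = c" using u0 v0 by (simp add: c_def power_divide field_simps)
  have n: "n > 0" using A by simp
  have e: "eval_fls A (subst_monom c k f) = subst_monom 1 n (subst_monom c k f)"
  proof -
    have "eval_fls A (subst_monom c k f) = subst_monom c k (subst_monom 1 n f)"
      using subst_monom_eval_fls[OF c0 g(2), of A f] f(2) by simp
    also have "\<dots> = subst_monom (c ^ n) (k * n) f" using c0 g(2) n by (simp add: subst_monom_subst_monom)
    also have "\<dots> = subst_monom 1 n (subst_monom c k f)" using c0 g(2) n by (simp add: subst_monom_subst_monom cn mult.commute)
    finally show ?thesis .
  qed
  have "g = subst_monom c k f"
  proof (rule bottcher_equation_unique[OF A g(2) v0])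
    show "ord_ge (- int k) g" using ord_ge_subdegree[of g] g by simp
    show "fls_nth g (- int k) = v" by (simp add: v_def)
    show "ord_ge (- int k) (subst_monom c k f)"
      using ord_ge_subdegree[of "subst_monom c k f"] f by (simp add: subdegree_subst_monom[OF c0 g(2)])
    have "fls_nth (subst_monom c k f) (int k * (-1)) = fls_nth f (-1) * c powi (-1)"
      by (rule subst_monom_nth_mult[OF c0 g(2)])
    then show "fls_nth (subst_monom c k f) (- int k) = v" using u0 v0 by (simp add: u_def[symmetric] c_def)
  qed (use g e in auto)
  then show ?thesis using c0 by blast
qed

lemma degree_semiconj:
  fixes A B X :: "complex poly"
  assumes "A \<circ>\<^sub>p X = X \<circ>\<^sub>p B" "degree X > 0"
  shows "degree A = degree B"
  using arg_cong[OF assms(1), of degree] assms(2) by (simp add: degree_pcompose mult.commute)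

lemma semiconj_at_bottcher_series:
  assumes A: "degree A = n" "n \<ge> 2" and B: "degree B = n"
    and f: "fls_subdegree f = -1" "eval_fls A f = subst_monom 1 n f"
    and b: "fls_subdegree b = -1" "eval_fls B b = subst_monom 1 n b"
    and X: "degree X = k" "k > 0" "A \<circ>\<^sub>p X = X \<circ>\<^sub>p B"
  shows "\<exists>c. c \<noteq> 0 \<and> eval_fls X b = subst_monom c k f"
proof (rule bottcher_power_substitution[OF A f])
  have "eval_fls (A \<circ>\<^sub>p X) b = eval_fls (X \<circ>\<^sub>p B) b" using X(3) by simp
  then show "eval_fls A (eval_fls X b) = subst_monom 1 n (eval_fls X b)"
    using b(2) A by (simp add: subst_monom_eval_fls)
qed (use X b in \<open>simp_all add: subdegree_eval_fls_simple_pole\<close>)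

lemma ex_bottcher:
  assumes "degree A = n" "n \<ge> 2"
  shows "\<exists>f. fls_subdegree f = -1 \<and> eval_fls A f = subst_monom 1 n f"
proof -
  have a: "lead_coeff A \<noteq> 0" using assms by auto
  obtain u where u: "u \<noteq> 0" "u ^ (n - 1) = 1 / lead_coeff A"
    using ex_nonzero_root[of "n - 1" "1 / lead_coeff A"] assms a by auto
  have "u ^ n = u * u ^ (n - 1)" using assms(2) by (cases n) simp_all
  then have "lead_coeff A * u ^ n = u" using u a by simp
  with ex_bottcher_series[OF assms u(1)] show ?thesis by blast
qed

text \<open>Writing the degrees as \<open>g k\<close> and \<open>g l\<close> with coprime \<open>k\<close> and \<open>l\<close>, non-divisibility means \<open>k \<ge> 2\<close>,
and then \<open>l \<ge> k \<ge> 2\<close>. The first step of the tower leads from the Boettcher series of \<open>B\<close> to that of \<open>A\<close> and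
removes the common factor \<open>g\<close>.\<close>

lemma degree_dvd_of_semiconj:
  assumes A: "degree A \<ge> 2" "\<not> special_poly A"
    and X: "degree X > 0" "A \<circ>\<^sub>p X = X \<circ>\<^sub>p B"
    and Y: "degree X \<le> degree Y" "A \<circ>\<^sub>p Y = Y \<circ>\<^sub>p B"
  shows "degree X dvd degree Y"
proof (rule ccontr)
  assume ndvd: "\<not> degree X dvd degree Y"
  define n where "n = degree A"
  have n: "degree A = n" "n \<ge> 2" "degree B = n"
    using A degree_semiconj[OF X(2,1)] by (simp_all add: n_def)
  obtain f where f: "fls_subdegree f = -1" "eval_fls A f = subst_monom 1 n f"
    using ex_bottcher[OF n(1,2)] by blast
  obtain b where b: "fls_subdegree b = -1" "eval_fls B b = subst_monom 1 n b"
    using ex_bottcher[OF n(3,2)] by blast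
  define g where "g = gcd (degree X) (degree Y)"
  obtain k l where kl: "degree X = g * k" "degree Y = g * l" "coprime k l" and g: "g > 0"
    using gcd_coprime_exists[of "degree X" "degree Y"] X(1) unfolding g_def
    by (metis gcd_pos_nat mult.commute less_irrefl)
  have k: "k \<noteq> 0" "k \<noteq> 1" using X(1) ndvd kl by auto
  have "k \<le> l" using Y(1) g by (simp add: kl)
  then have kl2: "k \<ge> 2" "l \<ge> 2" using k by auto
  obtain c d where "c \<noteq> 0" "eval_fls X b = subst_monom c (g * k) f" "d \<noteq> 0" "eval_fls Y b = subst_monom d (g * l) f"
    using semiconj_at_bottcher_series[OF n f b kl(1) _ X(2)] semiconj_at_bottcher_series[OF n f b kl(2) _ Y(2)] g kl2 by auto
  then have "descends_twice (g * k) (g * l) b f"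
    unfolding descends_twice_def using f b by blast
  then obtain s where "descends_twice l k f s"
    using descends_twice_step[of g k l b f] g kl2 kl(3) by auto
  then have "special_poly A"
    using special_if_coprime_descents[of l k f s A n] kl2 kl(3) n f by (simp add: coprime_commute)
  then show False using A by simp
qed

text \<open>The left factor is the polynomial part of \<open>f(w^m / d')\<close> with respect to \<open>f\<close>, where \<open>f\<close> is the
Boettcher series of \<open>A\<close> and \<open>m\<close> is the quotient of the degrees.\<close>

lemma left_factor_of_semiconj:
  fixes A B X Y :: "complex poly"
  assumes A: "degree A \<ge> 2"
    and X: "degree X > 0" "A \<circ>\<^sub>p X = X \<circ>\<^sub>p B"
    and Y: "degree Y > 0" "A \<circ>\<^sub>p Y = Y \<circ>\<^sub>p B"
    and dvd: "degree X dvd degree Y"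
  shows "\<exists>C. C \<circ>\<^sub>p A = A \<circ>\<^sub>p C \<and> Y = C \<circ>\<^sub>p X"
proof -
  define n k where "n = degree A" and "k = degree X"
  obtain m where m: "degree Y = k * m" using dvd by (auto simp: k_def)
  have n: "degree A = n" "n \<ge> 2" "degree B = n"
    using A degree_semiconj[OF X(2,1)] by (simp_all add: n_def)
  obtain f where f: "fls_subdegree f = -1" "eval_fls A f = subst_monom 1 n f"
    using ex_bottcher[OF n(1,2)] by blast
  obtain b where b: "fls_subdegree b = -1" "eval_fls B b = subst_monom 1 n b"
    using ex_bottcher[OF n(3,2)] by blast
  have k: "k > 0" "m > 0" using X Y m by (auto simp: k_def intro!: Nat.gr0I)
  obtain c where c: "c \<noteq> 0" "eval_fls X b = subst_monom c k f"
    using semiconj_at_bottcher_series[OF n f b _ _ X(2)] k by (auto simp: k_def)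
  obtain d where d: "d \<noteq> 0" "eval_fls Y b = subst_monom d (k * m) f"
    using semiconj_at_bottcher_series[OF n f b m _ Y(2)] k by auto
  define d' where "d' = d / c ^ m"
  have d': "d' \<noteq> 0" "d' * c ^ m = d" using c d by (simp_all add: d'_def)
  obtain C where C: "ord_ge 1 (eval_fls C f - subst_monom d' m f)"
    using ex_polynomial_part[OF f(1)] by blast
  have "ord_ge 1 (subst_monom c k (eval_fls C f - subst_monom d' m f))"
    using c(1) k(1) C by (rule ord_ge_subst_monom) (use k in simp)
  also have "subst_monom c k (eval_fls C f - subst_monom d' m f) = eval_fls (C \<circ>\<^sub>p X - Y) b"
    using c d d' k by (simp add: subst_monom_diff subst_monom_eval_fls subst_monom_subst_monom)
  finally have CX: "C \<circ>\<^sub>p X = Y"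
    using eval_fls_eq_0_if_ord_ge_1[OF b(1)] by (metis right_minus_eq)
  have "(C \<circ>\<^sub>p A) \<circ>\<^sub>p X = (A \<circ>\<^sub>p C) \<circ>\<^sub>p X"
    by (metis CX X(2) Y(2) pcompose_assoc)
  then have "(C \<circ>\<^sub>p A - A \<circ>\<^sub>p C) \<circ>\<^sub>p X = 0" by (simp add: pcompose_diff)
  then have "C \<circ>\<^sub>p A = A \<circ>\<^sub>p C" using X(1) by (simp add: pcompose_eq_0_iff)
  then show ?thesis using CX by blast
qed

theorem theorem1p3:
  fixes A B X0 :: "complex poly"
  assumes "degree A \<ge> 2" and "degree B \<ge> 2"
    and "\<not> special_poly A" and "\<not> special_poly B"
    and "semiconj_polys A B \<noteq> {}"
    and "X0 \<in> semiconj_polys A B"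
    and "\<forall>Y \<in> semiconj_polys A B. degree X0 \<le> degree Y"
  shows "\<forall>X :: complex poly. X \<in> semiconj_polys A B \<longleftrightarrow>
    (\<exists>A' :: complex poly. degree A' \<ge> 1 \<and> A' \<circ>\<^sub>p A = A \<circ>\<^sub>p A' \<and> X = A' \<circ>\<^sub>p X0)"
proof (intro allI iffI)
  fix X
  have X0: "degree X0 \<ge> 2" "A \<circ>\<^sub>p X0 = X0 \<circ>\<^sub>p B"
    using assms(6) by (simp_all add: semiconj_polys_def)
  {
    assume "X \<in> semiconj_polys A B"
    then have X: "degree X \<ge> 2" "A \<circ>\<^sub>p X = X \<circ>\<^sub>p B" and "degree X0 \<le> degree X"
      using assms(7) by (auto simp: semiconj_polys_def)
    then have "degree X0 dvd degree X"
      using degree_dvd_of_semiconj[OF assms(1,3)] X0 by simp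
    then obtain A' where A': "A' \<circ>\<^sub>p A = A \<circ>\<^sub>p A'" "X = A' \<circ>\<^sub>p X0"
      using left_factor_of_semiconj[OF assms(1) _ X0(2) _ X(2)] X0(1) X(1) by auto
    moreover have "degree A' \<ge> 1"
      using X(1) A'(2) by (cases "degree A'") (simp_all add: degree_pcompose)
    ultimately show "\<exists>A'. degree A' \<ge> 1 \<and> A' \<circ>\<^sub>p A = A \<circ>\<^sub>p A' \<and> X = A' \<circ>\<^sub>p X0" by blast
  }
  assume "\<exists>A'. degree A' \<ge> 1 \<and> A' \<circ>\<^sub>p A = A \<circ>\<^sub>p A' \<and> X = A' \<circ>\<^sub>p X0"
  then obtain A' where A': "degree A' \<ge> 1" "A' \<circ>\<^sub>p A = A \<circ>\<^sub>p A'" "X = A' \<circ>\<^sub>p X0" by blast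
  have "A \<circ>\<^sub>p X = X \<circ>\<^sub>p B"
    unfolding A'(3) by (metis A'(2) X0(2) pcompose_assoc)
  moreover have "degree X \<ge> 2"
    using mult_le_mono[OF A'(1) X0(1)] by (simp add: A'(3) degree_pcompose)
  ultimately show "X \<in> semiconj_polys A B" by (simp add: semiconj_polys_def)
qed

end
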